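(* Let $d\ge2$, $\varepsilon\in(0,\tfrac12]$ and let $P$ be a set of $n$ points in $\mathbb{H}^d$. There is a Steiner $(1+\varepsilon)$-spanner for $P$ with Steiner vertex set $Q$ that is bipartite on $P$ and $Q$, in which every point of $P$ has degree at most $d^{O(d)}\,\varepsilon^{(1-d)/2}\log\frac1\varepsilon$ when $d\ge3$, and at most $O\!\left(\frac1\varepsilon\log\frac1\varepsilon\right)$ when $d=2$.
   Context: $\mathbb{H}^d$ is hyperbolic $d$-space of curvature $-1$. A Steiner $t$-spanner for finite $P$ is a geometric graph $G$ (edges weighted by distance of endpoints) on $P\cup Q$, $Q$ finite and disjoint from $P$, with $\mathrm{dist}_G(u,v)\le t|uv|$ for all $u,v\in P$; it is bipartite on $P$ and $Q$ if every edge joins a point of $P$ to a point of $Q$. $O(\cdot)$ constants are absolute. *)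

theory Defs
  imports Complex_Main
begin

text \<open>Hyperboloid model of hyperbolic d-space H^d of curvature -1. Points are
  functions nat => real supported on coordinates 0..d, lying on the upper sheet
  of -x0^2 + x1^2 + ... + xd^2 = -1.\<close>

definition minkowski :: "nat \<Rightarrow> (nat \<Rightarrow> real) \<Rightarrow> (nat \<Rightarrow> real) \<Rightarrow> real" where
  "minkowski d x y = - (x 0 * y 0) + (\<Sum>i=1..d. x i * y i)"

definition hyp_space :: "nat \<Rightarrow> (nat \<Rightarrow> real) set" where
  "hyp_space d = {x. (\<forall>i>d. x i = 0) \<and> x 0 > 0 \<and> minkowski d x x = -1}"

definition hdist :: "nat \<Rightarrow> (nat \<Rightarrow> real) \<Rightarrow> (nat \<Rightarrow> real) \<Rightarrow> real" where
  "hdist d x y = arcosh (- minkowski d x y)"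

definition adj :: "('a \<times> 'a) set \<Rightarrow> 'a \<Rightarrow> 'a \<Rightarrow> bool" where
  "adj E a b \<longleftrightarrow> (a, b) \<in> E \<or> (b, a) \<in> E"

definition walk_len :: "('a \<Rightarrow> 'a \<Rightarrow> real) \<Rightarrow> 'a list \<Rightarrow> real" where
  "walk_len \<delta> ws = (\<Sum>i<length ws - 1. \<delta> (ws ! i) (ws ! Suc i))"

definition is_walk :: "('a \<times> 'a) set \<Rightarrow> 'a \<Rightarrow> 'a \<Rightarrow> 'a list \<Rightarrow> bool" where
  "is_walk E u v ws \<longleftrightarrow> ws \<noteq> [] \<and> hd ws = u \<and> last ws = v \<and>
     (\<forall>i < length ws - 1. adj E (ws ! i) (ws ! Suc i))"

definition graph_dist :: "('a \<Rightarrow> 'a \<Rightarrow> real) \<Rightarrow> ('a \<times> 'a) set \<Rightarrow> 'a \<Rightarrow> 'a \<Rightarrow> real" where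
  "graph_dist \<delta> E u v = Inf {walk_len \<delta> ws | ws. is_walk E u v ws}"

definition bipartite_steiner_spanner ::
  "nat \<Rightarrow> real \<Rightarrow> (nat \<Rightarrow> real) set \<Rightarrow> (nat \<Rightarrow> real) set \<Rightarrow> ((nat \<Rightarrow> real) \<times> (nat \<Rightarrow> real)) set \<Rightarrow> bool" where
  "bipartite_steiner_spanner d t P Q E \<longleftrightarrow>
     finite Q \<and> Q \<subseteq> hyp_space d \<and> P \<inter> Q = {} \<and> E \<subseteq> P \<times> Q \<and>
     (\<forall>u\<in>P. \<forall>v\<in>P. (\<exists>ws. is_walk E u v ws) \<and> graph_dist (hdist d) E u v \<le> t * hdist d u v)"

definition degree :: "('a \<times> 'a) set \<Rightarrow> 'a \<Rightarrow> nat" where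
  "degree E p = card {q. adj E p q}"

end

theory Submission
  imports Defs "HOL-Analysis.Convex" "HOL-Analysis.Harmonic_Numbers"
begin

text \<open>The points of \<open>P\<close> are clustered hierarchically with scales \<open>T\<^sub>n = \<tau> 8\<^sup>n\<close>: passing from one level
  to the next, every cluster that has another cluster within distance \<open>T\<^sub>n\<close> is merged with some
  cluster. A pair \<open>u, v\<close> with \<open>|uv|\<close> about \<open>R = T\<^sub>m\<close> is connected through representatives of the
  clusters of diameter \<open>O(\<epsilon>R)\<close> containing \<open>u\<close> and \<open>v\<close>, and recursively inside these clusters. Such a
  cluster has a neighbour within distance \<open>R\<close>, hence it stops being a cluster after
  \<open>O(log (1/\<epsilon>))\<close> levels and is used at that many scales only; moreover representatives can be chosen
  so that no point represents more than two clusters. It remains to give every point, for every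
  \<open>R\<close>, few Steiner neighbours in such a way that points at distance about \<open>R\<close> share
  a neighbour whose detour is \<open>O(\<epsilon>R)\<close>.

  In the half-space model, let \<open>r = min R 1\<close>. A detour through a point at distance \<open>\<eta>\<close> from a point
  of the geodesic, chosen at distance at least \<open>r/64\<close> from its ends, costs \<open>O(\<eta>\<^sup>2/r)\<close>. As long as
  \<open>\<epsilon>R = O(1)\<close>, a piece of length of order \<open>r\<close> near the top of the geodesic crosses
  a coordinate wall, on which a grid of width \<open>\<eta>\<close> with \<open>\<eta>\<^sup>2 = c \<epsilon>Rr/d\<close> provides the Steiner points;
  a point needs the grids near the vertical line through it at \<open>O(R + 1)\<close> height scales. For larger
  \<open>R\<close> a constant error is harmless, and grids at heights spaced by factors \<open>exp (\<epsilon>R/128)\<close>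
  suffice.\<close>

section \<open>The hyperboloid as a metric space\<close>

lemma minkowski_commute: "minkowski d x y = minkowski d y x"
  unfolding minkowski_def by (simp add: mult.commute)

lemma minkowski_lin_left:
  "minkowski d (\<lambda>i. a * x i + b * y i) z = a * minkowski d x z + b * minkowski d y z"
  unfolding minkowski_def
  by (simp add: sum.distrib sum_distrib_left algebra_simps)

lemma minkowski_lin_right:
  "minkowski d z (\<lambda>i. a * x i + b * y i) = a * minkowski d z x + b * minkowski d z y"
  using minkowski_lin_left[of d a x b y z] by (simp add: minkowski_commute)

text \<open>The half-space coordinates of a point of the hyperboloid; the last one, of index \<open>d\<close>,
  is the height.\<close>

definition half_coord :: "nat \<Rightarrow> (nat \<Rightarrow> real) \<Rightarrow> nat \<Rightarrow> real" where
  "half_coord d X j = (if j = d then 1 else X j) / (X 0 - X d)"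

text \<open>The inverse of the half-space chart. The height \<open>z = 1 / (X 0 - X d)\<close> and
  the equation of the hyperboloid give \<open>X 0 + X d = |e|^2 / z\<close>; solving for
  \<open>X 0\<close> and \<open>X d\<close> yields the first two branches.\<close>

definition from_half :: "nat \<Rightarrow> (nat \<Rightarrow> real) \<Rightarrow> nat \<Rightarrow> real" where
  "from_half d e j =
    (if j = 0 then ((\<Sum>i=1..d. (e i)\<^sup>2) + 1) / (2 * e d)
     else if j = d then ((\<Sum>i=1..d. (e i)\<^sup>2) - 1) / (2 * e d)
     else if j < d then e j / e d else 0)"

lemma sum_split_last:
  fixes f :: "nat \<Rightarrow> real"
  assumes "d \<ge> 1"
  shows "(\<Sum>i=1..d. f i) = (\<Sum>i=1..<d. f i) + f d"
proof -
  have "{1..d} = insert d {1..<d}" using assms by auto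
  then show ?thesis by simp
qed

lemma hyp_space_sq:
  assumes "X \<in> hyp_space d" "d \<ge> 1"
  shows "(X 0)\<^sup>2 = 1 + (\<Sum>i=1..<d. (X i)\<^sup>2) + (X d)\<^sup>2"
  using assms(1) unfolding hyp_space_def minkowski_def sum_split_last[OF assms(2)]
  by (simp add: power2_eq_square)

lemma hyp_space_lightcone_pos:
  assumes "X \<in> hyp_space d" "d \<ge> 1"
  shows "X 0 - X d > 0"
proof -
  have "(X d)\<^sup>2 < (X 0)\<^sup>2"
    using hyp_space_sq[OF assms] sum_nonneg[of "{1..<d}" "\<lambda>i. (X i)\<^sup>2"] by simp
  moreover have "X 0 > 0" using assms unfolding hyp_space_def by simp
  ultimately show ?thesis
    using power2_less_imp_less[of "X d" "X 0"] by simp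
qed

lemma height_pos:
  assumes "X \<in> hyp_space d" "d \<ge> 1"
  shows "half_coord d X d > 0"
  using hyp_space_lightcone_pos[OF assms] by (simp add: half_coord_def)

text \<open>The half-space formula for the cosh of the distance, which links distances to Euclidean
  coordinates. Expanding the squares leaves \<open>A\<close> and \<open>B\<close>, and these are
  eliminated by the hyperboloid equation factored as \<open>a * (X 0 + X d) = A + 1\<close>.\<close>

lemma minkowski_half_coord:
  assumes X: "X \<in> hyp_space d" and Y: "Y \<in> hyp_space d" and d: "d \<ge> 1"
  shows "- minkowski d X Y = 1 + (\<Sum>j=1..d. (half_coord d X j - half_coord d Y j)\<^sup>2)
           / (2 * half_coord d X d * half_coord d Y d)"
proof -
  define a where "a = X 0 - X d"
  define b where "b = Y 0 - Y d"
  have ab: "a > 0" "b > 0"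
    using hyp_space_lightcone_pos assms unfolding a_def b_def by auto
  define A where "A = (\<Sum>i=1..<d. (X i)\<^sup>2)"
  define B where "B = (\<Sum>i=1..<d. (Y i)\<^sup>2)"
  define C where "C = (\<Sum>i=1..<d. X i * Y i)"
  have A: "A = a * (X 0 + X d) - 1" and B: "B = b * (Y 0 + Y d) - 1"
    using hyp_space_sq[OF X d] hyp_space_sq[OF Y d] unfolding A_def B_def a_def b_def
    by (auto simp: algebra_simps power2_eq_square)
  have "(\<Sum>j=1..<d. (half_coord d X j - half_coord d Y j)\<^sup>2)
      = (\<Sum>j=1..<d. (X j / a - Y j / b)\<^sup>2)"
    by (intro sum.cong) (auto simp: half_coord_def a_def b_def)
  also have "\<dots> = (\<Sum>j=1..<d. (X j)\<^sup>2 / a\<^sup>2 + (Y j)\<^sup>2 / b\<^sup>2 - 2 * (X j * Y j) / (a * b))"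
    by (intro sum.cong) (auto simp: power2_diff power_divide)
  also have "\<dots> = A / a\<^sup>2 + B / b\<^sup>2 - 2 * C / (a * b)"
    unfolding A_def B_def C_def
    by (simp add: sum.distrib sum_subtractf sum_divide_distrib[symmetric] sum_distrib_left[symmetric])
  finally have s: "(\<Sum>j=1..d. (half_coord d X j - half_coord d Y j)\<^sup>2)
      = A / a\<^sup>2 + B / b\<^sup>2 - 2 * C / (a * b) + (1 / a - 1 / b)\<^sup>2"
    unfolding sum_split_last[OF d] by (simp add: half_coord_def a_def b_def)
  have m: "minkowski d X Y = - (X 0 * Y 0) + C + X d * Y d"
    unfolding minkowski_def C_def sum_split_last[OF d] by simp
  have h: "2 * half_coord d X d * half_coord d Y d = 2 / (a * b)"
    by (simp add: half_coord_def a_def b_def)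
  have "(A / a\<^sup>2 + B / b\<^sup>2 - 2 * C / (a * b) + (1 / a - 1 / b)\<^sup>2) / (2 / (a * b))
      = (b * (A + 1) / a + a * (B + 1) / b) / 2 - C - 1"
    using ab by (simp add: field_simps power2_eq_square)
  also have "\<dots> = (b * (X 0 + X d) + a * (Y 0 + Y d)) / 2 - C - 1"
    using ab by (simp add: A B)
  also have "\<dots> = X 0 * Y 0 - X d * Y d - C - 1"
    by (simp add: a_def b_def field_simps)
  finally show ?thesis
    unfolding s h m by linarith
qed

text \<open>Since \<open>(x - y)^2 + 2 x y = x^2 + y^2\<close>, the summand 1 can be absorbed into
  the height term; this separates the horizontal offset from the heights.\<close>

lemma minkowski_half_coord':
  assumes X: "X \<in> hyp_space d" and Y: "Y \<in> hyp_space d" and d: "d \<ge> 1"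
  shows "- minkowski d X Y = ((\<Sum>j=1..<d. (half_coord d X j - half_coord d Y j)\<^sup>2)
           + (half_coord d X d)\<^sup>2 + (half_coord d Y d)\<^sup>2) / (2 * half_coord d X d * half_coord d Y d)"
  using height_pos[OF X d] height_pos[OF Y d]
  unfolding minkowski_half_coord[OF assms] sum_split_last[OF d]
  by (simp add: field_simps power2_eq_square)

lemma from_half:
  assumes d: "d \<ge> 1" and e: "e d > 0"
  shows from_half_in: "from_half d e \<in> hyp_space d"
    and half_coord_from_half: "j \<in> {1..d} \<Longrightarrow> half_coord d (from_half d e) j = e j"
proof -
  define s where "s = (\<Sum>i=1..<d. (e i)\<^sup>2)"
  define z where "z = e d"
  have z: "z > 0" using e z_def by simp
  have s0: "s \<ge> 0" unfolding s_def by (simp add: sum_nonneg)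
  have sum: "(\<Sum>i=1..d. (e i)\<^sup>2) = s + z\<^sup>2" unfolding sum_split_last[OF d] by (simp add: s_def z_def)
  have c0: "from_half d e 0 = (s + z\<^sup>2 + 1) / (2 * z)"
    unfolding from_half_def sum by (simp add: z_def)
  have cd: "from_half d e d = (s + z\<^sup>2 - 1) / (2 * z)"
    unfolding from_half_def sum using d by (simp add: z_def)
  have "(\<Sum>i=1..<d. from_half d e i * from_half d e i) = (\<Sum>i=1..<d. (e i)\<^sup>2 / z\<^sup>2)"
    by (intro sum.cong) (auto simp: from_half_def z_def power2_eq_square)
  also have "\<dots> = s / z\<^sup>2" by (simp add: s_def sum_divide_distrib)
  finally have "minkowski d (from_half d e) (from_half d e) =
     - ((s + z\<^sup>2 + 1) / (2 * z))\<^sup>2 + s / z\<^sup>2 + ((s + z\<^sup>2 - 1) / (2 * z))\<^sup>2"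
    unfolding minkowski_def sum_split_last[OF d] by (simp add: c0 cd power2_eq_square)
  also have "\<dots> = -1"
    using z by (simp add: field_simps power2_eq_square)
  finally show "from_half d e \<in> hyp_space d"
    unfolding hyp_space_def using z s0 d
    by (auto simp: c0 add_nonneg_pos) (simp add: from_half_def)
  have diff: "from_half d e 0 - from_half d e d = 1 / z"
    using z unfolding c0 cd by (simp add: field_simps)
  show "half_coord d (from_half d e) j = e j" if "j \<in> {1..d}"
    using that z unfolding half_coord_def diff by (auto simp: z_def from_half_def)
qed

section \<open>The metric axioms of hyperbolic distance\<close>

lemma minkowski_ge_1:
  assumes "X \<in> hyp_space d" "Y \<in> hyp_space d" "d \<ge> 1"
  shows "- minkowski d X Y \<ge> 1"
  using height_pos[of X d] height_pos[of Y d] assms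
  by (simp add: minkowski_half_coord sum_nonneg)

lemma hdist_nonneg:
  assumes "X \<in> hyp_space d" "Y \<in> hyp_space d" "d \<ge> 1"
  shows "hdist d X Y \<ge> 0"
  using minkowski_ge_1[OF assms] unfolding hdist_def by simp

lemma cosh_hdist:
  assumes "X \<in> hyp_space d" "Y \<in> hyp_space d" "d \<ge> 1"
  shows "cosh (hdist d X Y) = - minkowski d X Y"
  using minkowski_ge_1[OF assms] unfolding hdist_def by simp

lemma hdist_commute: "hdist d X Y = hdist d Y X"
  unfolding hdist_def by (simp add: minkowski_commute)

lemma hdist_refl:
  assumes "X \<in> hyp_space d"
  shows "hdist d X X = 0"
  using assms unfolding hdist_def hyp_space_def by simp

lemma hdist_le_iff:
  assumes "X \<in> hyp_space d" "Y \<in> hyp_space d" "d \<ge> 1" "t \<ge> 0"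
  shows "hdist d X Y \<le> t \<longleftrightarrow> - minkowski d X Y \<le> cosh t"
  using cosh_hdist[OF assms(1-3)] hdist_nonneg[OF assms(1-3)] assms(4)
  by (metis cosh_real_nonneg_le_iff)

text \<open>Distance zero forces equal half-space coordinates, and the chart is injective: equal
  heights mean equal \<open>X 0 - X d\<close>, after which the hyperboloid equation recovers
  \<open>X 0 + X d\<close>.\<close>

lemma hdist_pos:
  assumes X: "X \<in> hyp_space d" and Y: "Y \<in> hyp_space d" and d: "d \<ge> 1" and ne: "X \<noteq> Y"
  shows "hdist d X Y > 0"
proof (rule ccontr)
  assume "\<not> hdist d X Y > 0"
  then have "hdist d X Y = 0" using hdist_nonneg[OF X Y d] by simp
  then have "- minkowski d X Y = 1" using cosh_hdist[OF X Y d] by simp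
  then have "(\<Sum>j=1..d. (half_coord d X j - half_coord d Y j)\<^sup>2) = 0"
    using minkowski_half_coord[OF X Y d] height_pos[OF X d] height_pos[OF Y d] by simp
  then have eq: "half_coord d X j = half_coord d Y j" if "j \<in> {1..d}" for j
    using that by (subst (asm) sum_nonneg_eq_0_iff) auto
  have w: "X 0 - X d = Y 0 - Y d"
    using eq[of d] d by (simp add: half_coord_def)
  have lt: "X j = Y j" if "j \<in> {1..<d}" for j
    using eq[of j] that w hyp_space_lightcone_pos[OF Y d] by (auto simp: half_coord_def)
  then have "(\<Sum>i=1..<d. (X i)\<^sup>2) = (\<Sum>i=1..<d. (Y i)\<^sup>2)" by simp
  then have "(X 0 - X d) * (X 0 + X d) = (Y 0 - Y d) * (Y 0 + Y d)"
    using hyp_space_sq[OF X d] hyp_space_sq[OF Y d] by (simp add: algebra_simps power2_eq_square)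
  then have "X 0 + X d = Y 0 + Y d"
    using w hyp_space_lightcone_pos[OF Y d] by simp
  then have "X 0 = Y 0" "X d = Y d" using w by auto
  then have "X j = Y j" for j
    using lt[of j] X Y unfolding hyp_space_def
    by (cases "j = 0"; cases "j = d"; cases "j > d") auto
  then show False using ne by auto
qed

text \<open>The form is positive semidefinite on the orthogonal complement of a timelike vector:
  with \<open>(y 0)^2 = 1 + t\<close>, Cauchy-Schwarz gives
  \<open>(w 0)^2 * (1 + t) \<le> s * t\<close>.\<close>

lemma minkowski_orthogonal_nonneg:
  assumes y: "y \<in> hyp_space d" and o: "minkowski d w y = 0"
  shows "minkowski d w w \<ge> 0"
proof -
  define s where "s = (\<Sum>i=1..d. (w i)\<^sup>2)"
  define t where "t = (\<Sum>i=1..d. (y i)\<^sup>2)"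
  have t: "(y 0)\<^sup>2 = 1 + t" "y 0 > 0"
    using y unfolding hyp_space_def minkowski_def t_def by (auto simp: power2_eq_square)
  have s0: "s \<ge> 0" "t \<ge> 0" unfolding s_def t_def by (simp_all add: sum_nonneg)
  have "w 0 * y 0 = (\<Sum>i=1..d. w i * y i)" using o unfolding minkowski_def by simp
  then have "(w 0 * y 0)\<^sup>2 \<le> s * t"
    using Cauchy_Schwarz_ineq_sum[of w y "{1..d}"] unfolding s_def t_def by simp
  then have "(w 0)\<^sup>2 * (1 + t) \<le> s * t" by (simp add: power_mult_distrib t)
  then have "(w 0)\<^sup>2 * (1 + t) \<le> s * (1 + t)" using s0 by (simp add: algebra_simps)
  then have "(w 0)\<^sup>2 \<le> s" using s0 by (simp add: mult_le_cancel_right)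
  then show ?thesis unfolding minkowski_def s_def by (simp add: power2_eq_square)
qed

text \<open>Supplies Cauchy-Schwarz for a form that may be degenerate, so \<open>c = 0\<close> has
  to be covered: there a nonconstant affine function would take negative values.\<close>

lemma nonneg_quadratic_discriminant:
  fixes a b c :: real
  assumes c: "c \<ge> 0" and pos: "\<And>t. a + 2 * b * t + c * t\<^sup>2 \<ge> 0"
  shows "b\<^sup>2 \<le> a * c"
proof (cases "c = 0")
  case True
  have "b = 0"
  proof (rule ccontr)
    assume "b \<noteq> 0"
    then show False using pos[of "- (a + 1) / (2 * b)"] True by (simp add: field_simps)
  qed
  then show ?thesis using True by simp
next
  case False
  then have "c > 0" using c by simp
  then show ?thesis using pos[of "- b / c"] by (simp add: field_simps power2_eq_square)
qed

text \<open>The components \<open>x'\<close> and \<open>z'\<close> orthogonal to \<open>y\<close>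
  have norms \<open>sinh a\<close> and \<open>sinh c\<close>. Cauchy-Schwarz on that complement
  bounds the angle term of the hyperbolic law of cosines, leaving at most
  \<open>cosh a * cosh c + sinh a * sinh c = cosh (a + c)\<close>.\<close>

lemma hdist_triangle:
  assumes x: "x \<in> hyp_space d" and y: "y \<in> hyp_space d" and z: "z \<in> hyp_space d" and d: "d \<ge> 1"
  shows "hdist d x z \<le> hdist d x y + hdist d y z"
proof -
  define a where "a = hdist d x y"
  define c where "c = hdist d y z"
  have a: "a \<ge> 0" "minkowski d x y = - cosh a"
    using hdist_nonneg[OF x y d] cosh_hdist[OF x y d] by (auto simp: a_def)
  have c: "c \<ge> 0" "minkowski d y z = - cosh c" "minkowski d z y = - cosh c"
    using hdist_nonneg[OF y z d] cosh_hdist[OF y z d] by (auto simp: c_def minkowski_commute)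
  have self: "minkowski d x x = -1" "minkowski d y y = -1" "minkowski d z z = -1"
    using x y z unfolding hyp_space_def by auto
  define x' where "x' = (\<lambda>i. 1 * x i + (- cosh a) * y i)"
  define z' where "z' = (\<lambda>i. 1 * z i + (- cosh c) * y i)"
  have ip: "minkowski d x' x' = (sinh a)\<^sup>2" "minkowski d z' z' = (sinh c)\<^sup>2"
    "minkowski d x' z' = minkowski d x z + cosh a * cosh c"
    "minkowski d z' x' = minkowski d x z + cosh a * cosh c"
    "minkowski d x' y = 0" "minkowski d z' y = 0"
    unfolding x'_def z'_def minkowski_lin_left minkowski_lin_right
    using a c self by (simp_all add: minkowski_commute[of d y x] minkowski_commute[of d z x]
        cosh_square_eq[unfolded power2_eq_square] power2_eq_square algebra_simps)
  define m where "m = minkowski d x' z'"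
  have "(sinh a)\<^sup>2 + 2 * m * t + (sinh c)\<^sup>2 * t\<^sup>2 \<ge> 0" for t
  proof -
    have "minkowski d (\<lambda>i. 1 * x' i + t * z' i) y = 0"
      unfolding minkowski_lin_left using ip by simp
    then have "minkowski d (\<lambda>i. 1 * x' i + t * z' i) (\<lambda>i. 1 * x' i + t * z' i) \<ge> 0"
      by (rule minkowski_orthogonal_nonneg[OF y])
    then show ?thesis
      unfolding minkowski_lin_left minkowski_lin_right using ip
      by (simp add: m_def algebra_simps power2_eq_square)
  qed
  then have "m\<^sup>2 \<le> (sinh a)\<^sup>2 * (sinh c)\<^sup>2" by (intro nonneg_quadratic_discriminant) auto
  then have "\<bar>m\<bar> \<le> sinh a * sinh c"
    using a c by (metis abs_le_square_iff abs_of_nonneg mult_nonneg_nonneg power_mult_distrib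
        sinh_real_nonneg_iff)
  then have "- minkowski d x z \<le> cosh (a + c)"
    using ip(3) by (simp add: m_def cosh_add)
  then show ?thesis
    using hdist_le_iff[OF x z d, of "a + c"] a c by (simp add: a_def c_def)
qed

section \<open>Detours through points near a geodesic\<close>

text \<open>The unit-speed geodesic as a linear combination of its ends, so that its product with a
  third point is the same combination of the products with \<open>u\<close> and \<open>v\<close>. If
  \<open>hdist d u v = 0\<close>, division by zero makes it the zero vector; hence the positivity
  assumptions below.\<close>

definition geod :: "nat \<Rightarrow> (nat \<Rightarrow> real) \<Rightarrow> (nat \<Rightarrow> real) \<Rightarrow> real \<Rightarrow> nat \<Rightarrow> real" where
  "geod d u v s = (let L = hdist d u v in
     (\<lambda>i. (sinh (L - s) / sinh L) * u i + (sinh s / sinh L) * v i))"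

lemma minkowski_geod:
  assumes u: "u \<in> hyp_space d" and v: "v \<in> hyp_space d" and d: "d \<ge> 1" and L: "hdist d u v > 0"
  shows "minkowski d (geod d u v s) (geod d u v t) = - cosh (s - t)"
proof -
  define L where "L = hdist d u v"
  define S where "S = sinh L"
  define C where "C = cosh L"
  have S0: "S > 0" using L by (simp add: S_def L_def)
  have CS: "C\<^sup>2 = S\<^sup>2 + 1" by (simp add: C_def S_def cosh_square_eq)
  have uv: "minkowski d u v = - C" "minkowski d v u = - C"
    using cosh_hdist[OF u v d] by (auto simp: L_def C_def minkowski_commute)
  have self: "minkowski d u u = -1" "minkowski d v v = -1"
    using u v unfolding hyp_space_def by auto
  have sd: "sinh (L - r) = S * cosh r - C * sinh r" for r
    by (simp add: sinh_diff S_def C_def)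
  have "minkowski d (geod d u v s) (geod d u v t) =
    - (((S * cosh s - C * sinh s) * (S * cosh t - C * sinh t) + sinh s * sinh t
       + C * ((S * cosh s - C * sinh s) * sinh t + sinh s * (S * cosh t - C * sinh t))) / S\<^sup>2)"
    unfolding geod_def Let_def minkowski_lin_left minkowski_lin_right uv self
      L_def[symmetric] sd S_def[symmetric]
    using S0 by (simp add: field_simps power2_eq_square)
  also have "(S * cosh s - C * sinh s) * (S * cosh t - C * sinh t) + sinh s * sinh t
       + C * ((S * cosh s - C * sinh s) * sinh t + sinh s * (S * cosh t - C * sinh t))
     = S\<^sup>2 * (cosh s * cosh t) + (1 - C\<^sup>2) * (sinh s * sinh t)"
    by (simp add: algebra_simps power2_eq_square)
  also have "\<dots> = S\<^sup>2 * cosh (s - t)"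
    unfolding CS by (simp add: cosh_diff algebra_simps)
  finally show ?thesis using S0 by simp
qed

lemma geod_in:
  assumes u: "u \<in> hyp_space d" and v: "v \<in> hyp_space d" and d: "d \<ge> 1"
    and L: "hdist d u v > 0" and s: "0 \<le> s" "s \<le> hdist d u v"
  shows "geod d u v s \<in> hyp_space d"
proof -
  have p: "u 0 > 0" "v 0 > 0" and z: "\<forall>i>d. u i = 0" "\<forall>i>d. v i = 0"
    using u v unfolding hyp_space_def by auto
  define L where "L = hdist d u v"
  have nn: "sinh (L - s) / sinh L \<ge> 0" "sinh s / sinh L \<ge> 0"
    using s L by (auto simp: L_def)
  have "geod d u v s 0 > 0"
  proof (cases "s = 0")
    case True
    then show ?thesis unfolding geod_def Let_def L_def[symmetric] using L p by (simp add: L_def)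
  next
    case False
    then have "sinh s / sinh L > 0" using s L by (auto simp: L_def)
    then show ?thesis unfolding geod_def Let_def L_def[symmetric]
      using nn p by (intro add_nonneg_pos mult_pos_pos mult_nonneg_nonneg) auto
  qed
  then show ?thesis
    using minkowski_geod[OF u v d L, of s s] z
    unfolding hyp_space_def by (auto simp: geod_def Let_def)
qed

lemma hdist_geod:
  assumes "u \<in> hyp_space d" "v \<in> hyp_space d" "d \<ge> 1" "hdist d u v > 0"
  shows "hdist d (geod d u v s) (geod d u v t) = \<bar>s - t\<bar>"
  using minkowski_geod[OF assms, of s t] unfolding hdist_def
  by (metis abs_ge_zero arcosh_cosh_real cosh_real_abs minus_minus)

lemma geod_0: "hdist d u v > 0 \<Longrightarrow> geod d u v 0 = u"
  and geod_end: "hdist d u v > 0 \<Longrightarrow> geod d u v (hdist d u v) = v"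
  by (auto simp: geod_def Let_def)

text \<open>Since \<open>arcosh\<close> is concave, it lies below its tangents.\<close>

lemma cosh_tangent:
  fixes a t :: real
  assumes "a > 0" "t \<ge> 0"
  shows "t \<le> a + (cosh t - cosh a) / sinh a"
proof -
  have "(t - a) * sinh a \<le> cosh t - cosh a"
  proof -
    have "cosh t = cosh a * cosh (t - a) + sinh a * sinh (t - a)"
      using cosh_add[of a "t - a"] by simp
    moreover have "sinh a * (t - a) \<le> cosh a * (cosh (t - a) - 1) + sinh a * sinh (t - a)"
    proof -
      have "(t - a) \<le> (cosh (t - a) - 1) + sinh (t - a)"
        using exp_ge_add_one_self[of "t - a"] by (simp add: cosh_plus_sinh[symmetric])
      then have "sinh a * (t - a) \<le> sinh a * ((cosh (t - a) - 1) + sinh (t - a))"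
        using assms by (intro mult_left_mono) auto
      also have "\<dots> = sinh a * (cosh (t - a) - 1) + sinh a * sinh (t - a)"
        by (simp add: algebra_simps)
      also have "sinh a * (cosh (t - a) - 1) \<le> cosh a * (cosh (t - a) - 1)"
        using sinh_le_cosh_real[of a] cosh_real_ge_1[of "t - a"] by (intro mult_right_mono) auto
      finally show ?thesis by simp
    qed
    ultimately show ?thesis by (simp add: algebra_simps)
  qed
  then have "t - a \<le> (cosh t - cosh a) / sinh a"
    using assms by (simp add: pos_le_divide_eq)
  then show ?thesis by simp
qed

text \<open>This is \<open>coth a \<le> 1 + 1 / a\<close>, which follows from
  \<open>a * exp (- a) \<le> sinh a\<close>; because \<open>r \<le> 1\<close>, a second
  \<open>1 / r\<close> absorbs the summand 1.\<close>

lemma coth_le: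
  fixes a r :: real
  assumes "0 < r" "r \<le> a" "r \<le> 1"
  shows "cosh a / sinh a \<le> 2 / r"
proof -
  have sa: "sinh a > 0" using assms by simp
  have "a * exp (- a) \<le> sinh a"
  proof -
    have "1 + 2 * a \<le> exp (2 * a)" by (rule exp_ge_add_one_self)
    also have "exp (2 * a) = exp a * exp a" by (simp flip: exp_add)
    finally show ?thesis by (simp add: sinh_def exp_minus field_simps)
  qed
  then have "a * (cosh a - sinh a) \<le> sinh a" by (simp add: cosh_minus_sinh)
  moreover have "r * (cosh a - sinh a) \<le> a * (cosh a - sinh a)"
    using assms sinh_le_cosh_real[of a] by (intro mult_right_mono) auto
  moreover have "r * sinh a \<le> 1 * sinh a" using assms sa by (intro mult_right_mono) auto
  ultimately have "r * cosh a \<le> 2 * sinh a" by (simp add: algebra_simps)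
  then show ?thesis using sa assms by (simp add: field_simps)
qed

text \<open>The first-order terms of the two distances cancel because the point of the geodesic is a
  linear combination of its ends.\<close>

lemma detour_le:
  assumes u: "u \<in> hyp_space d" and v: "v \<in> hyp_space d" and d: "d \<ge> 1" and q: "q \<in> hyp_space d"
    and r: "0 < r" "r \<le> 1" "r \<le> s" "s \<le> hdist d u v - r"
  shows "hdist d u q + hdist d q v \<le> hdist d u v + (4 / r) * (- minkowski d (geod d u v s) q - 1)"
proof -
  define L where "L = hdist d u v"
  have L: "L > 0" using r by (simp add: L_def)
  define D where "D = - minkowski d (geod d u v s) q"
  have g: "geod d u v s \<in> hyp_space d"
    using geod_in[OF u v d] r L by (simp add: L_def)
  have D1: "D \<ge> 1" unfolding D_def using minkowski_ge_1[OF g q d] .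
  have s: "s > 0" "L - s > 0" using r by (auto simp: L_def)
  have sp: "sinh s > 0" "sinh (L - s) > 0" "sinh L > 0" using s L by auto
  have Deq: "sinh L * D = sinh (L - s) * cosh (hdist d u q) + sinh s * cosh (hdist d q v)"
    using sp unfolding D_def geod_def Let_def L_def[symmetric] minkowski_lin_left
      cosh_hdist[OF u q d] cosh_hdist[OF q v d] minkowski_commute[of d q v]
    by (simp add: field_simps)
  have "hdist d u q \<le> s + (cosh (hdist d u q) - cosh s) / sinh s"
    using s hdist_nonneg[OF u q d] by (intro cosh_tangent) auto
  moreover have "hdist d q v \<le> (L - s) + (cosh (hdist d q v) - cosh (L - s)) / sinh (L - s)"
    using s hdist_nonneg[OF q v d] by (intro cosh_tangent) auto
  ultimately have "hdist d u q + hdist d q v \<le> L +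
     (cosh (hdist d u q) / sinh s + cosh (hdist d q v) / sinh (L - s)
       - (cosh s / sinh s + cosh (L - s) / sinh (L - s)))"
    by (simp add: diff_divide_distrib)
  also have "cosh (hdist d u q) / sinh s + cosh (hdist d q v) / sinh (L - s)
      = sinh L * D / (sinh s * sinh (L - s))"
    unfolding Deq using sp by (simp add: field_simps)
  \<comment> \<open>The addition formula turns the coefficient of \<open>D\<close> into the very sum
    of \<open>coth\<close> terms that the tangent bounds subtract, so only a multiple of
    \<open>D - 1\<close> survives.\<close>
  also have "sinh L = sinh s * cosh (L - s) + cosh s * sinh (L - s)"
    using sinh_add[of s "L - s"] by simp
  also have "(sinh s * cosh (L - s) + cosh s * sinh (L - s)) * D / (sinh s * sinh (L - s))
      = (cosh s / sinh s + cosh (L - s) / sinh (L - s)) * D"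
    using sp by (simp add: field_simps)
  also have "(cosh s / sinh s + cosh (L - s) / sinh (L - s)) * D
       - (cosh s / sinh s + cosh (L - s) / sinh (L - s))
      = (cosh s / sinh s + cosh (L - s) / sinh (L - s)) * (D - 1)"
    by (simp only: right_diff_distrib mult_1_right)
  also have "\<dots> \<le> (4 / r) * (D - 1)"
    using coth_le[of r s] coth_le[of r "L - s"] r D1
    by (intro mult_right_mono) (auto simp: L_def)
  finally show ?thesis by (simp add: L_def D_def)
qed

section \<open>Heights and coordinates along a geodesic\<close>

lemma sinh_ge_self:
  fixes x :: real
  assumes "x \<ge> 0"
  shows "x \<le> sinh x"
proof -
  have "\<exists>c. sinh x - sinh 0 = (x - 0) * c \<and> 1 \<le> c" if "x > 0"
  proof -
    have "\<exists>z. 0 < z \<and> z < x \<and> sinh x - sinh 0 = (x - 0) * cosh z"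
      using that by (intro MVT2) (auto intro!: derivative_eq_intros)
    then show ?thesis using cosh_real_ge_1 by blast
  qed
  then show ?thesis using assms
    by (cases "x = 0") (auto simp: mult_le_cancel_left1)
qed

lemma sinh_le_exp:
  fixes x :: real
  shows "sinh x \<le> x * exp x"
proof -
  have "1 - exp (- (2 * x)) \<le> 2 * x" using exp_ge_add_one_self[of "- (2 * x)"] by simp
  then have "exp x * (1 - exp (- (2 * x))) \<le> exp x * (2 * x)"
    by (intro mult_left_mono) auto
  moreover have "exp x * exp (- (2 * x)) = exp (- x)" by (simp flip: exp_add)
  ultimately show ?thesis by (simp add: sinh_def algebra_simps)
qed

lemma cosh_minus_one: "cosh x - 1 = 2 * (sinh (x / 2))\<^sup>2" for x :: real
  using cosh_double[of "x / 2"] cosh_square_eq[of "x / 2"] by simp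

lemma cosh_minus_one_ge: "x \<ge> 0 \<Longrightarrow> x\<^sup>2 / 2 \<le> cosh x - 1" for x :: real
proof -
  assume "x \<ge> 0"
  then have "(x / 2)\<^sup>2 \<le> (sinh (x / 2))\<^sup>2" using sinh_ge_self[of "x / 2"] by (intro power_mono) auto
  then show ?thesis unfolding cosh_minus_one by (simp add: power_divide)
qed

lemma cosh_minus_one_le:
  fixes x :: real
  assumes "0 \<le> x" "x \<le> 2"
  shows "cosh x - 1 \<le> 5 * x\<^sup>2"
proof -
  have "exp (x / 2) \<le> exp 1" using assms by simp
  then have "exp (x / 2) \<le> 3" using exp_le by linarith
  then have "x / 2 * exp (x / 2) \<le> x / 2 * 3" using assms by (intro mult_left_mono) auto
  then have "sinh (x / 2) \<le> x / 2 * 3" using sinh_le_exp[of "x / 2"] by linarith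
  then have "(sinh (x / 2))\<^sup>2 \<le> (x / 2 * 3)\<^sup>2" using assms by (intro power_mono) auto
  also have "\<dots> = 9 / 4 * x\<^sup>2" by (simp add: power_mult_distrib power_divide)
  finally show ?thesis unfolding cosh_minus_one using zero_le_power2[of x] by linarith
qed

text \<open>Dropping the horizontal squares leaves \<open>cosh (ln (a / b))\<close>, the value for
  two points on one vertical line: moving vertically is the cheapest way to change height.\<close>

lemma height_le:
  assumes X: "X \<in> hyp_space d" and Y: "Y \<in> hyp_space d" and d: "d \<ge> 1"
  shows "half_coord d X d \<le> exp (hdist d X Y) * half_coord d Y d"
proof -
  define a where "a = half_coord d X d"
  define b where "b = half_coord d Y d"
  define D where "D = hdist d X Y"
  have ab: "a > 0" "b > 0" using height_pos assms by (auto simp: a_def b_def)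
  have D: "D \<ge> 0" using hdist_nonneg[OF assms] by (simp add: D_def)
  have "cosh D \<ge> (a\<^sup>2 + b\<^sup>2) / (2 * a * b)"
    unfolding D_def cosh_hdist[OF assms] minkowski_half_coord'[OF assms] a_def[symmetric] b_def[symmetric]
    using ab by (intro divide_right_mono) (auto simp: sum_nonneg)
  also have "(a\<^sup>2 + b\<^sup>2) / (2 * a * b) = cosh (ln (a / b))"
    using ab by (simp add: cosh_ln_real field_simps power2_eq_square)
  finally have "\<bar>ln (a / b)\<bar> \<le> D"
    using D by (metis abs_ge_zero cosh_real_abs cosh_real_nonneg_le_iff)
  then have "a / b \<le> exp D" using ab by (metis abs_le_D1 divide_pos_pos exp_le_cancel_iff exp_ln)
  then show ?thesis using ab by (simp add: a_def b_def D_def field_simps)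
qed

lemma coord_diff_sq_le:
  assumes X: "X \<in> hyp_space d" and Y: "Y \<in> hyp_space d" and d: "d \<ge> 1" and j: "j \<in> {1..d}"
  shows "(half_coord d X j - half_coord d Y j)\<^sup>2
      \<le> 2 * half_coord d X d * half_coord d Y d * (cosh (hdist d X Y) - 1)"
proof -
  have "(half_coord d X j - half_coord d Y j)\<^sup>2 \<le> (\<Sum>j=1..d. (half_coord d X j - half_coord d Y j)\<^sup>2)"
    using j by (intro member_le_sum) auto
  then show ?thesis
    using height_pos[OF X d] height_pos[OF Y d]
    unfolding cosh_hdist[OF X Y d] minkowski_half_coord[OF X Y d] by simp
qed

text \<open>The left side is the squared Euclidean size of the pair, offset and heights together. It
  is compared with the top height of the geodesic below.\<close>

lemma extent_sq_eq:
  assumes X: "X \<in> hyp_space d" and Y: "Y \<in> hyp_space d" and d: "d \<ge> 1"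
  shows "(\<Sum>j=1..<d. (half_coord d X j - half_coord d Y j)\<^sup>2)
           + (half_coord d X d)\<^sup>2 + (half_coord d Y d)\<^sup>2
      = 2 * half_coord d X d * half_coord d Y d * cosh (hdist d X Y)"
  using height_pos[OF X d] height_pos[OF Y d]
  unfolding cosh_hdist[OF X Y d] minkowski_half_coord'[OF X Y d] by simp

text \<open>The inverse height is the linear functional \<open>X 0 - X d\<close>, hence it is the
  same combination of its end values as the point. Every other coordinate is a quotient of two
  linear functionals, which makes it a weighted average of its end values.\<close>

lemma geod_coord:
  assumes u: "u \<in> hyp_space d" and v: "v \<in> hyp_space d" and d: "d \<ge> 1"
    and s: "0 \<le> s" "s \<le> hdist d u v" and L: "hdist d u v > 0"
  defines "w \<equiv> (\<lambda>t. sinh t / sinh (hdist d u v))"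
  shows inv_height_geod: "1 / half_coord d (geod d u v s) d
      = w (hdist d u v - s) / half_coord d u d + w s / half_coord d v d"
    and coord_geod_between: "j \<noteq> d \<Longrightarrow> \<bar>half_coord d (geod d u v s) j - half_coord d u j\<bar>
      \<le> \<bar>half_coord d u j - half_coord d v j\<bar>"
      "j \<noteq> d \<Longrightarrow> \<bar>half_coord d (geod d u v s) j - half_coord d v j\<bar>
      \<le> \<bar>half_coord d u j - half_coord d v j\<bar>"
proof -
  define a where "a = u 0 - u d"
  define b where "b = v 0 - v d"
  have ab: "a > 0" "b > 0" using hyp_space_lightcone_pos u v d by (auto simp: a_def b_def)
  define p where "p = w (hdist d u v - s)"
  define q where "q = w s"
  have pq: "p \<ge> 0" "q \<ge> 0" using s L by (auto simp: p_def q_def w_def)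
  have g: "geod d u v s i = p * u i + q * v i" for i
    by (simp add: geod_def Let_def p_def q_def w_def)
  have gd: "geod d u v s 0 - geod d u v s d = p * a + q * b"
    by (simp add: g a_def b_def algebra_simps)
  have pos: "p * a + q * b > 0"
    using hyp_space_lightcone_pos[OF geod_in[OF u v d L s] d] gd by simp
  show "1 / half_coord d (geod d u v s) d
      = w (hdist d u v - s) / half_coord d u d + w s / half_coord d v d"
    unfolding p_def[symmetric] q_def[symmetric]
    by (simp add: half_coord_def gd a_def[symmetric] b_def[symmetric])
  assume j: "j \<noteq> d"
  define x where "x = half_coord d u j"
  define y where "y = half_coord d v j"
  have uv: "u j = x * a" "v j = y * b"
    using j ab by (auto simp: x_def y_def half_coord_def a_def b_def)
  define l where "l = q * b / (p * a + q * b)"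
  have l: "0 \<le> l" "l \<le> 1" using pq ab pos by (auto simp: l_def)
  have "half_coord d (geod d u v s) j = (p * a * x + q * b * y) / (p * a + q * b)"
    unfolding half_coord_def gd using j by (simp add: g uv algebra_simps)
  also have "\<dots> = x + l * (y - x)"
    using pos by (simp add: l_def field_simps)
  finally have e: "half_coord d (geod d u v s) j = x + l * (y - x)" .
  have "\<bar>l * (y - x)\<bar> \<le> 1 * \<bar>y - x\<bar>"
    unfolding abs_mult using l by (intro mult_right_mono) auto
  then show "\<bar>half_coord d (geod d u v s) j - half_coord d u j\<bar>
      \<le> \<bar>half_coord d u j - half_coord d v j\<bar>"
    unfolding e x_def[symmetric] y_def[symmetric] by (simp add: abs_minus_commute)
  have "\<bar>(1 - l) * (x - y)\<bar> \<le> 1 * \<bar>x - y\<bar>"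
    unfolding abs_mult using l by (intro mult_right_mono) auto
  moreover have "x + l * (y - x) - y = (1 - l) * (x - y)" by (simp add: algebra_simps)
  ultimately show "\<bar>half_coord d (geod d u v s) j - half_coord d v j\<bar>
      \<le> \<bar>half_coord d u j - half_coord d v j\<bar>"
    unfolding e x_def[symmetric] y_def[symmetric] by simp
qed

lemma continuous_on_coord_geod:
  assumes u: "u \<in> hyp_space d" and v: "v \<in> hyp_space d" and d: "d \<ge> 1"
    and L: "hdist d u v > 0"
  shows "continuous_on {0..hdist d u v} (\<lambda>s. half_coord d (geod d u v s) j)"
proof -
  have c: "continuous_on {0..hdist d u v} (\<lambda>s. geod d u v s i)" for i
    unfolding geod_def Let_def using L by (intro continuous_intros) auto
  have "geod d u v s 0 - geod d u v s d \<noteq> 0" if "s \<in> {0..hdist d u v}" for s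
    using hyp_space_lightcone_pos[OF geod_in[OF u v d L] d, of s] that by auto
  then show ?thesis
    unfolding half_coord_def by (cases "j = d") (auto intro!: continuous_intros c)
qed

lemma sinh_ratio_le:
  fixes s L :: real
  assumes "0 \<le> s" "0 < L"
  shows "sinh (L - s) / sinh L \<le> exp (- s)"
proof -
  have "exp (- L - s) \<le> exp (- (L - s))" using assms by simp
  then have "sinh (L - s) \<le> exp (- s) * sinh L"
    by (simp add: sinh_def algebra_simps flip: exp_add)
  then show ?thesis using assms by (simp add: field_simps)
qed

text \<open>The geodesic from \<open>u\<close> to \<open>v\<close> is highest near the parameter \<open>L/2 + ln (z\<^sub>v/z\<^sub>u)/2\<close>, where
  the two contributions to the inverse height are balanced.\<close>

lemma geod_high_point:
  assumes u: "u \<in> hyp_space d" and v: "v \<in> hyp_space d" and d: "d \<ge> 1"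
    and \<rho>: "0 < \<rho>" "\<rho> \<le> 1 / 64" "4 * \<rho> \<le> hdist d u v"
  obtains s where "2 * \<rho> \<le> s" "s \<le> hdist d u v - 2 * \<rho>"
    "half_coord d u d \<le> 4 * half_coord d (geod d u v s) d"
    "half_coord d v d \<le> 4 * half_coord d (geod d u v s) d"
    "\<And>j. j \<in> {1..<d} \<Longrightarrow> \<bar>half_coord d u j - half_coord d v j\<bar> \<le> 4 * half_coord d (geod d u v s) d"
proof -
  define L where "L = hdist d u v"
  define a where "a = half_coord d u d"
  define b where "b = half_coord d v d"
  have L: "L > 0" using \<rho> by (simp add: L_def)
  have ab: "a > 0" "b > 0" using height_pos u v d by (auto simp: a_def b_def)
  have lnab: "ln a \<le> L + ln b" "ln b \<le> L + ln a"
  proof -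
    have "a \<le> exp L * b" using height_le[OF u v d] by (simp add: a_def b_def L_def)
    then have "ln a \<le> ln (exp L * b)" using ab by simp
    then show "ln a \<le> L + ln b" using ab by (simp add: ln_mult)
    have "b \<le> exp L * a" using height_le[OF v u d] by (simp add: a_def b_def L_def hdist_commute)
    then have "ln b \<le> ln (exp L * a)" using ab by simp
    then show "ln b \<le> L + ln a" using ab by (simp add: ln_mult)
  qed
  define t where "t = (L + ln b - ln a) / 2"
  \<comment> \<open>At the parameter \<open>t\<close> the bounds for both contributions to the
    inverse height equal \<open>exp (- m)\<close>, so \<open>exp m\<close> stands for the top
    height; moreover \<open>exp (2 * m) = a * b * exp L\<close>.\<close>
  define m where "m = (L + ln a + ln b) / 2"
  \<comment> \<open>Clamping keeps \<open>s\<close> away from the ends and moves it by at most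
    \<open>2 * \<rho>\<close>, which costs a factor
    \<open>exp (2 * \<rho>) \<le> 4 / 3\<close>.\<close>
  define s where "s = max (2 * \<rho>) (min t (L - 2 * \<rho>))"
  have t: "0 \<le> t" "t \<le> L" using lnab by (auto simp: t_def)
  have s: "2 * \<rho> \<le> s" "s \<le> L - 2 * \<rho>" using \<rho> by (auto simp: s_def L_def)
  have st: "- s \<le> 2 * \<rho> - t" "s - L \<le> 2 * \<rho> + (t - L)"
    using t \<rho> by (auto simp: s_def L_def)
  define z where "z = half_coord d (geod d u v s) d"
  have z: "z > 0" unfolding z_def
    using s \<rho> L by (intro height_pos geod_in u v d) (auto simp: L_def)
  have "1 / z = sinh (L - s) / sinh L / a + sinh s / sinh L / b"
    unfolding z_def a_def b_def L_def
    using s \<rho> L by (intro inv_height_geod u v d) (auto simp: L_def)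
  also have "\<dots> \<le> exp (- s) / a + exp (s - L) / b"
    using sinh_ratio_le[of s L] sinh_ratio_le[of "L - s" L] s \<rho> L ab
    by (intro add_mono divide_right_mono) auto
  also have "\<dots> \<le> exp (2 * \<rho> - t) / a + exp (2 * \<rho> + (t - L)) / b"
    using st ab by (intro add_mono divide_right_mono) auto
  also have "exp (2 * \<rho> - t) / a = exp (2 * \<rho>) * exp (- m)"
  proof -
    have "exp (2 * \<rho> - t) / a = exp (2 * \<rho> - t - ln a)" using ab by (simp add: exp_diff)
    also have "2 * \<rho> - t - ln a = 2 * \<rho> + (- m)" by (simp add: t_def m_def field_simps)
    finally show ?thesis by (simp only: exp_add)
  qed
  also have "exp (2 * \<rho> + (t - L)) / b = exp (2 * \<rho>) * exp (- m)"
  proof -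
    have "exp (2 * \<rho> + (t - L)) / b = exp (2 * \<rho> + (t - L) - ln b)" using ab by (simp add: exp_diff)
    also have "2 * \<rho> + (t - L) - ln b = 2 * \<rho> + (- m)" by (simp add: t_def m_def field_simps)
    finally show ?thesis by (simp only: exp_add)
  qed
  finally have "1 / z \<le> 2 * exp (2 * \<rho>) * exp (- m)" by (simp add: mult.commute)
  also have "\<dots> \<le> 2 * (4 / 3) * exp (- m)"
  proof -
    have "exp (2 * \<rho>) \<le> 1 + 2 * \<rho> + (2 * \<rho>)\<^sup>2" using \<rho> by (intro exp_bound) auto
    also have "(2 * \<rho>)\<^sup>2 \<le> (1 / 32)\<^sup>2" using \<rho> by (intro power_mono) auto
    finally have "exp (2 * \<rho>) \<le> 4 / 3" using \<rho> by (simp add: power2_eq_square)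
    then show ?thesis by (intro mult_mono) auto
  qed
  finally have zm: "3 / 2 * exp m \<le> 4 * z"
    using z by (simp add: exp_minus field_simps)
  define S where "S = (\<Sum>j=1..<d. (half_coord d u j - half_coord d v j)\<^sup>2)"
  have S: "S + a\<^sup>2 + b\<^sup>2 = 2 * a * b * cosh L"
    using extent_sq_eq[OF u v d] by (simp add: S_def a_def b_def L_def)
  have "cosh L \<le> exp L" using L by (simp add: cosh_def)
  then have "2 * a * b * cosh L \<le> 2 * a * b * exp L" using ab by (intro mult_left_mono) auto
  also have "a * b * exp L = exp (2 * m)"
  proof -
    have "2 * m = ln a + ln b + L" by (simp add: m_def)
    then show ?thesis using ab by (simp only: exp_add exp_ln)
  qed
  then have "2 * a * b * exp L = 2 * (exp m)\<^sup>2" by (simp add: exp_double)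
  finally have S2: "S + a\<^sup>2 + b\<^sup>2 \<le> 2 * (exp m)\<^sup>2" using S by simp
  have S0: "S \<ge> 0" by (simp add: S_def sum_nonneg)
  \<comment> \<open>The squared size of the pair is at most \<open>2 * (exp m)^2\<close>, and 2 is
    below \<open>9 / 4 = (3 / 2)^2\<close>; this is where the common factor 4 of all three
    conclusions comes from.\<close>
  have key: "x \<le> 4 * z" if "x\<^sup>2 \<le> S + a\<^sup>2 + b\<^sup>2" for x
  proof -
    have "(3 / 2 * exp m)\<^sup>2 = 9 / 4 * (exp m)\<^sup>2"
      by (simp add: power_mult_distrib power_divide)
    then have "x\<^sup>2 \<le> (3 / 2 * exp m)\<^sup>2"
      using that S2 zero_le_power2[of "exp m"] by linarith
    then have "x \<le> 3 / 2 * exp m" by (rule power2_le_imp_le) simp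
    then show ?thesis using zm by simp
  qed
  show thesis
  proof
    show "2 * \<rho> \<le> s" "s \<le> hdist d u v - 2 * \<rho>" using s by (auto simp: L_def)
    show "half_coord d u d \<le> 4 * half_coord d (geod d u v s) d"
      using key[of a] S0 by (simp add: a_def z_def)
    show "half_coord d v d \<le> 4 * half_coord d (geod d u v s) d"
      using key[of b] S0 by (simp add: b_def z_def)
    fix j assume "j \<in> {1..<d}"
    then have "(half_coord d u j - half_coord d v j)\<^sup>2 \<le> S"
      unfolding S_def by (intro member_le_sum) auto
    then show "\<bar>half_coord d u j - half_coord d v j\<bar> \<le> 4 * half_coord d (geod d u v s) d"
      using key[of "\<bar>half_coord d u j - half_coord d v j\<bar>"] by (simp add: z_def add_increasing2)
  qed
qed

section \<open>Grids of Steiner points\<close>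

lemma card_int_interval_le:
  fixes a b :: real
  assumes "a \<le> b"
  shows "finite {k::int. a \<le> k \<and> k \<le> b}" "real (card {k::int. a \<le> k \<and> k \<le> b}) \<le> b - a + 1"
proof -
  have e: "{k::int. a \<le> k \<and> k \<le> b} = {\<lceil>a\<rceil>..\<lfloor>b\<rfloor>}"
    by (auto simp: ceiling_le_iff le_floor_iff)
  show "finite {k::int. a \<le> k \<and> k \<le> b}" unfolding e by simp
  have "real (card {k::int. a \<le> k \<and> k \<le> b}) = real (nat (\<lfloor>b\<rfloor> - \<lceil>a\<rceil> + 1))"
    unfolding e by simp
  also have "\<dots> \<le> b - a + 1"
    using assms by (cases "\<lfloor>b\<rfloor> - \<lceil>a\<rceil> + 1 \<ge> 0") (simp_all, linarith)
  finally show "real (card {k::int. a \<le> k \<and> k \<le> b}) \<le> b - a + 1" .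
qed

definition lattice_interval :: "real \<Rightarrow> real \<Rightarrow> real \<Rightarrow> real set" where
  "lattice_interval s c w = {x. (\<exists>n::int. x = s * n) \<and> \<bar>x - c\<bar> \<le> w}"

lemma card_lattice_interval:
  assumes "s > 0" "w \<ge> 0"
  shows "finite (lattice_interval s c w)" "real (card (lattice_interval s c w)) \<le> 2 * w / s + 1"
proof -
  define I where "I = {k::int. (c - w) / s \<le> k \<and> k \<le> (c + w) / s}"
  have le: "(c - w) / s \<le> (c + w) / s" using assms by (simp add: divide_right_mono)
  have sub: "lattice_interval s c w \<subseteq> (\<lambda>n::int. s * n) ` I"
    using assms by (auto simp: lattice_interval_def I_def abs_le_iff field_simps)
  have fin: "finite I" and card: "real (card I) \<le> (c + w) / s - (c - w) / s + 1"
    using card_int_interval_le[OF le] by (auto simp: I_def)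
  show "finite (lattice_interval s c w)" using sub fin by (meson finite_imageI finite_subset)
  have "card (lattice_interval s c w) \<le> card I"
    using card_mono[OF _ sub] fin card_image_le[OF fin] by (meson finite_imageI le_trans)
  moreover have "(c + w) / s - (c - w) / s = 2 * w / s" by (simp flip: diff_divide_distrib)
  ultimately show "real (card (lattice_interval s c w)) \<le> 2 * w / s + 1"
    using card by linarith
qed

lemma round_up_bounds:
  fixes w x :: real
  assumes "w > 0"
  shows "x \<le> w * \<lceil>x / w\<rceil>" "w * \<lceil>x / w\<rceil> \<le> x + w"
proof -
  define n where "n = real_of_int \<lceil>x / w\<rceil>"
  have "x / w \<le> n" "n \<le> x / w + 1" unfolding n_def by linarith+
  then have "x \<le> w * n" "w * n \<le> x + w" using assms by (auto simp: field_simps)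
  then show "x \<le> w * \<lceil>x / w\<rceil>" "w * \<lceil>x / w\<rceil> \<le> x + w" by (auto simp: n_def)
qed

text \<open>The extensional product makes the tuples countable by \<open>card_PiE\<close>. The
  condition on \<open>e d\<close> discards nonpositive heights, which a lattice interval may
  contain.\<close>

definition grid :: "nat \<Rightarrow> (nat \<Rightarrow> real set) \<Rightarrow> (nat \<Rightarrow> real) set" where
  "grid d A = from_half d ` {e \<in> PiE {1..d} A. e d > 0}"

lemma grid_subset: "d \<ge> 1 \<Longrightarrow> grid d A \<subseteq> hyp_space d"
  unfolding grid_def using from_half_in by auto

lemma from_half_in_grid:
  assumes "d \<ge> 1" "e d > 0" "\<And>j. j \<in> {1..d} \<Longrightarrow> e j \<in> A j"
  shows "from_half d e \<in> grid d A"
proof -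
  have "from_half d e = from_half d (restrict e {1..d})"
    using assms(1) by (auto simp: from_half_def fun_eq_iff)
  then show ?thesis unfolding grid_def using assms by (intro image_eqI) auto
qed

lemma card_grid:
  assumes "\<And>j. j \<in> {1..d} \<Longrightarrow> finite (A j)"
  shows "finite (grid d A)" "card (grid d A) \<le> (\<Prod>j\<in>{1..d}. card (A j))"
proof -
  have f: "finite (PiE {1..d} A)" using assms by (intro finite_PiE) auto
  then show "finite (grid d A)" unfolding grid_def by simp
  have "card (grid d A) \<le> card {e \<in> PiE {1..d} A. e d > 0}"
    unfolding grid_def using f by (intro card_image_le) auto
  also have "\<dots> \<le> card (PiE {1..d} A)" using f by (intro card_mono) auto
  finally show "card (grid d A) \<le> (\<Prod>j\<in>{1..d}. card (A j))" by (simp add: card_PiE)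
qed

text \<open>The intermediate value theorem, applied to the first multiple of \<open>w\<close> at or
  above the smaller end value; a decreasing pair of end values is reduced to
  \<open>- f\<close>.\<close>

lemma exists_lattice_crossing:
  fixes f :: "real \<Rightarrow> real"
  assumes c: "continuous_on {a..b} f" and ab: "a \<le> b" and w: "0 < w" "w \<le> \<bar>f a - f b\<bar>"
  shows "\<exists>s\<in>{a..b}. \<exists>n::int. f s = w * n"
proof -
  have *: "\<exists>s\<in>{a..b}. \<exists>n::int. g s = w * n"
    if c: "continuous_on {a..b} g" and g: "w \<le> g b - g a" for g
  proof -
    define n where "n = \<lceil>g a / w\<rceil>"
    have "g a / w \<le> n" "n \<le> g a / w + 1" unfolding n_def by linarith+
    then have "g a \<le> w * n" "w * n \<le> g a + w" using w by (auto simp: field_simps)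
    then have "\<exists>s. a \<le> s \<and> s \<le> b \<and> g s = w * n"
      using g by (intro IVT' c ab) auto
    then show ?thesis by auto
  qed
  show ?thesis
  proof (cases "f a \<le> f b")
    case True
    then show ?thesis using *[OF c] w by auto
  next
    case False
    have "continuous_on {a..b} (\<lambda>x. - f x)" using c by (intro continuous_intros)
    from *[OF this] False w obtain s and n :: int where "s \<in> {a..b}" "- f s = w * n" by auto
    then have "f s = w * (of_int (- n))" by simp
    then show ?thesis using \<open>s \<in> {a..b}\<close> by blast
  qed
qed

subsection \<open>The fine grid\<close>

text \<open>At the height scale \<open>h = 2^k\<close> the grid consists of the points with one coordinate on a coarse
  lattice (so that they lie on a wall) and the remaining ones on a fine lattice. For
  \<open>R > 1\<close> the window for the height is centred at \<open>0\<close>, because the grids visible from a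
  point may lie far above it.\<close>

definition fine_centre :: "nat \<Rightarrow> real \<Rightarrow> (nat \<Rightarrow> real) \<Rightarrow> nat \<Rightarrow> real" where
  "fine_centre d R u j = (if j = d \<and> R > 1 then 0 else half_coord d u j)"

text \<open>Steps are relative to the cell size \<open>2 powr k * min R 1\<close>. The wall spacing
  is small enough that a piece of geodesic of length \<open>min R 1 / 32\<close> must cross a wall;
  the other spacing balances \<open>detour_le\<close> so that \<open>d\<close> rounded coordinates
  cost exactly \<open>\<epsilon> * R / 32\<close>.\<close>

definition fine_step :: "nat \<Rightarrow> real \<Rightarrow> real \<Rightarrow> nat \<Rightarrow> nat \<Rightarrow> real" where
  "fine_step d \<epsilon> R i j =
    (if j = i then 1 / (64 * d) else sqrt (\<epsilon> * R / (d * min R 1)) / 128)"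

text \<open>The scales that geodesics of length at most \<open>2 * R\<close> from \<open>u\<close>
  can ask for. The high point has at least a quarter of the height of \<open>u\<close> and rounding
  down to a power of 2 loses another factor 2, hence the 8; the upper bound is
  \<open>height_le\<close>.\<close>

definition fine_scales :: "nat \<Rightarrow> real \<Rightarrow> (nat \<Rightarrow> real) \<Rightarrow> int set" where
  "fine_scales d R u =
    {k. half_coord d u d / 8 \<le> 2 powr k \<and> 2 powr k \<le> exp (2 * R) * half_coord d u d}"

definition fine_set :: "nat \<Rightarrow> real \<Rightarrow> real \<Rightarrow> (nat \<Rightarrow> real) \<Rightarrow> nat \<Rightarrow> int \<Rightarrow> nat \<Rightarrow> real set" where
  "fine_set d \<epsilon> R u i k j = lattice_interval (fine_step d \<epsilon> R i j * (2 powr k * min R 1))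
     (fine_centre d R u j) (64 * (2 powr k * min R 1))"

text \<open>Around the high point, the piece of geodesic with parameters in \<open>{a..b}\<close>
  crosses a wall. Rounding the remaining coordinates of the crossing point gives \<open>q\<close>,
  and the rounding depends on the geodesic only, so it suffices that \<open>q\<close> lies in the
  windows of both ends.\<close>

lemma fine_common_point:
  assumes u: "u \<in> hyp_space d" and v: "v \<in> hyp_space d" and d: "d \<ge> 1"
    and \<epsilon>: "0 < \<epsilon>" "\<epsilon> \<le> 1" and R: "0 < R" "\<epsilon> * R \<le> 256"
    and L: "R / 16 \<le> hdist d u v" "hdist d u v \<le> 2 * R"
  shows "\<exists>i\<in>{1..d}. \<exists>k\<in>fine_scales d R u \<inter> fine_scales d R v.
    \<exists>q\<in>grid d (fine_set d \<epsilon> R u i k) \<inter> grid d (fine_set d \<epsilon> R v i k).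
      hdist d u q + hdist d q v \<le> hdist d u v + \<epsilon> * R / 32"
proof -
  define r where "r = min R 1"
  define \<rho> where "\<rho> = r / 64"
  define L where "L = hdist d u v"
  define \<beta> where "\<beta> = sqrt (\<epsilon> * R / (d * r)) / 128"
  have r: "0 < r" "r \<le> 1" "r \<le> R" using R by (auto simp: r_def)
  have \<rho>: "0 < \<rho>" "\<rho> \<le> 1 / 64" "4 * \<rho> \<le> L" using r L by (auto simp: \<rho>_def L_def)
  have L0: "L > 0" using \<rho> by simp
  have d0: "real d \<ge> 1" using d by simp
  have \<beta>2: "\<beta>\<^sup>2 = \<epsilon> * R / (16384 * d * r)"
    using \<epsilon> R r d by (simp add: \<beta>_def power_divide)
  have \<beta>0: "\<beta> > 0" using \<epsilon> R r d by (simp add: \<beta>_def)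
  \<comment> \<open>For \<open>R \<le> 1\<close> this is \<open>\<epsilon> \<le> 1\<close>,
    otherwise it is the assumption on \<open>\<epsilon> * R\<close>. It yields
    \<open>\<beta> \<le> 1\<close>: rounding moves a coordinate by at most one cell
    \<open>h * r\<close>.\<close>
  have "\<epsilon> * R \<le> 256 * r"
    using R \<epsilon> by (cases "R \<le> 1") (auto simp: r_def intro: mult_right_mono)
  also have "\<dots> \<le> 16384 * d * r" using d0 r by (intro mult_right_mono) auto
  finally have "\<beta>\<^sup>2 \<le> 1\<^sup>2" unfolding \<beta>2 using d0 r by (simp add: field_simps)
  then have \<beta>1: "\<beta> \<le> 1" by (rule power2_le_imp_le) simp
  define g where "g = geod d u v"
  define z where "z = (\<lambda>s. half_coord d (g s) d)"
  have g: "g s \<in> hyp_space d" if "0 \<le> s" "s \<le> L" for s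
    using geod_in[OF u v d] that L0 by (simp add: g_def L_def)
  have zpos: "z s > 0" if "0 \<le> s" "s \<le> L" for s
    using height_pos[OF g[OF that] d] by (simp add: z_def)
  have gg: "hdist d (g s) (g t) = \<bar>s - t\<bar>" for s t
    using hdist_geod[OF u v d] L0 by (simp add: g_def L_def)
  have g0: "g 0 = u" "g L = v"
    using geod_0[of d u v] geod_end[of d u v] L0 by (auto simp: g_def L_def)
  have du: "hdist d u (g s) = \<bar>s\<bar>" and dv: "hdist d v (g s) = \<bar>L - s\<bar>" for s
    using gg[of 0 s] gg[of L s] by (auto simp: g0)
  obtain s0 where s0: "2 * \<rho> \<le> s0" "s0 \<le> L - 2 * \<rho>" "half_coord d u d \<le> 4 * z s0"
    "half_coord d v d \<le> 4 * z s0"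
    and s0x: "\<And>j. j \<in> {1..<d} \<Longrightarrow> \<bar>half_coord d u j - half_coord d v j\<bar> \<le> 4 * z s0"
    using geod_high_point[OF u v d, of \<rho>] \<rho> unfolding z_def g_def L_def by metis
  have s0L: "0 \<le> s0" "s0 \<le> L" using s0 \<rho> by auto
  define k where "k = \<lfloor>log 2 (z s0)\<rfloor>"
  define h where "h = 2 powr k"
  have h0: "h > 0" by (simp add: h_def)
  have h: "h \<le> z s0" "z s0 \<le> 2 * h"
  proof -
    have "real_of_int k \<le> log 2 (z s0)" "log 2 (z s0) \<le> k + 1" by (auto simp: k_def)
    then have "h \<le> 2 powr (log 2 (z s0))" "2 powr (log 2 (z s0)) \<le> 2 powr (k + 1)"
      by (auto simp: h_def)
    then show "h \<le> z s0" "z s0 \<le> 2 * h" using zpos[OF s0L] by (auto simp: h_def powr_add)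
  qed
  have ku: "k \<in> fine_scales d R u"
  proof -
    have "z s0 \<le> exp s0 * half_coord d u d"
      using height_le[OF g[OF s0L] u d] s0L du[of s0] by (simp add: z_def hdist_commute)
    also have "\<dots> \<le> exp (2 * R) * half_coord d u d"
      using s0L L height_pos[OF u d] by (intro mult_right_mono) (auto simp: L_def)
    finally show ?thesis using h s0 unfolding fine_scales_def h_def by auto
  qed
  have kv: "k \<in> fine_scales d R v"
  proof -
    have "z s0 \<le> exp (L - s0) * half_coord d v d"
      using height_le[OF g[OF s0L] v d] s0L dv[of s0] by (simp add: z_def hdist_commute)
    also have "\<dots> \<le> exp (2 * R) * half_coord d v d"
      using s0L L height_pos[OF v d] by (intro mult_right_mono) (auto simp: L_def)
    finally show ?thesis using h s0 unfolding fine_scales_def h_def by auto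
  qed
  define a where "a = s0 - \<rho>"
  define b where "b = s0 + \<rho>"
  have ab: "\<rho> \<le> a" "a \<le> b" "b \<le> L - \<rho>" using s0 \<rho> by (auto simp: a_def b_def)
  \<comment> \<open>Parameters in the piece differ from \<open>s0\<close> by at most
    \<open>\<rho> \<le> 1 / 64\<close>, so heights change by a factor below 2.\<close>
  have zab: "h / 2 \<le> z s" "z s \<le> 4 * h" if "a \<le> s" "s \<le> b" for s
  proof -
    have s: "0 \<le> s" "s \<le> L" using that ab \<rho> by auto
    have D: "hdist d (g s) (g s0) \<le> 1 / 64"
      unfolding gg using that \<rho> unfolding a_def b_def by linarith
    have e: "exp (1 / 64::real) \<le> 2"
      using exp_bound[of "1 / 64::real"] by (simp add: power2_eq_square)
    have "z s0 \<le> exp (hdist d (g s) (g s0)) * z s"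
      using height_le[OF g[OF s0L] g[OF s] d] by (simp add: z_def hdist_commute)
    also have "\<dots> \<le> 2 * z s"
    proof (rule mult_right_mono)
      have "exp (hdist d (g s) (g s0)) \<le> exp (1 / 64)" using D by simp
      then show "exp (hdist d (g s) (g s0)) \<le> 2" using e by linarith
    qed (use zpos[OF s] in auto)
    finally show "h / 2 \<le> z s" using h by simp
    have "z s \<le> exp (hdist d (g s) (g s0)) * z s0"
      using height_le[OF g[OF s] g[OF s0L] d] by (simp add: z_def)
    also have "\<dots> \<le> 2 * z s0"
    proof (rule mult_right_mono)
      have "exp (hdist d (g s) (g s0)) \<le> exp (1 / 64)" using D by simp
      then show "exp (hdist d (g s) (g s0)) \<le> 2" using e by linarith
    qed (use zpos[OF s0L] in auto)
    finally show "z s \<le> 4 * h" using h by simp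
  qed
  have abL: "0 \<le> a" "a \<le> L" "0 \<le> b" "b \<le> L" using ab \<rho> by auto
  \<comment> \<open>Note that \<open>1 / (64 * d) * (h * r)\<close> is
    \<open>h * \<rho> / d\<close>. If all \<open>d\<close> changes were smaller, the squared
    Euclidean displacement would be below \<open>(h * \<rho>)^2\<close>, which contradicts length
    \<open>2 * \<rho>\<close> at heights at least \<open>h / 2\<close>.\<close>
  have "\<exists>i\<in>{1..d}. 1 / (64 * d) * (h * r) \<le> \<bar>half_coord d (g a) i - half_coord d (g b) i\<bar>"
  proof (rule ccontr)
    assume "\<not> ?thesis"
    then have lt: "\<bar>half_coord d (g a) j - half_coord d (g b) j\<bar> < 1 / (64 * d) * (h * r)"
      if "j \<in> {1..d}" for j using that by (meson not_le)
    have "(\<Sum>j=1..d. (half_coord d (g a) j - half_coord d (g b) j)\<^sup>2)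
        < (\<Sum>j=1..d. (1 / (64 * d) * (h * r))\<^sup>2)"
    proof (rule sum_strict_mono)
      fix j assume "j \<in> {1..d}"
      from lt[OF this] show "(half_coord d (g a) j - half_coord d (g b) j)\<^sup>2 < (1 / (64 * d) * (h * r))\<^sup>2"
        by (metis abs_ge_zero power2_abs power_strict_mono zero_less_numeral)
    qed (use d in auto)
    also have "\<dots> = (h * \<rho>)\<^sup>2 / d"
      using d by (simp add: \<rho>_def power_divide power_mult_distrib power2_eq_square)
    also have "\<dots> \<le> (h * \<rho>)\<^sup>2"
      using d0 by (simp add: divide_le_eq mult_le_cancel_left1)
    finally have lt: "(\<Sum>j=1..d. (half_coord d (g a) j - half_coord d (g b) j)\<^sup>2) < (h * \<rho>)\<^sup>2" .
    have "(\<Sum>j=1..d. (half_coord d (g a) j - half_coord d (g b) j)\<^sup>2)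
        = 2 * z a * z b * (cosh (b - a) - 1)"
    proof -
      have "hdist d (g a) (g b) = b - a" using gg[of a b] ab by simp
      then have "cosh (b - a) = - minkowski d (g a) (g b)"
        using cosh_hdist[OF g g d, of a b] abL by simp
      then show ?thesis
        using minkowski_half_coord[OF g g d, of a b] abL zpos[of a] zpos[of b] by (simp add: z_def)
    qed
    also have "\<dots> \<ge> 2 * (h / 2) * (h / 2) * ((b - a)\<^sup>2 / 2)"
      using zab[of a] zab[of b] ab h0 cosh_minus_one_ge[of "b - a"] by (intro mult_mono) auto
    also have "2 * (h / 2) * (h / 2) * ((b - a)\<^sup>2 / 2) = (h * \<rho>)\<^sup>2"
      by (simp add: a_def b_def power2_eq_square)
    finally show False using lt by simp
  qed
  then obtain i where i: "i \<in> {1..d}"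
    "1 / (64 * d) * (h * r) \<le> \<bar>half_coord d (g a) i - half_coord d (g b) i\<bar>" by blast
  have "continuous_on {a..b} (\<lambda>s. half_coord d (g s) i)"
    unfolding g_def
    by (rule continuous_on_subset[OF continuous_on_coord_geod[OF u v d]])
      (use L0 abL in \<open>auto simp: L_def\<close>)
  then obtain s and n :: int where s: "a \<le> s" "s \<le> b"
    and n: "half_coord d (g s) i = 1 / (64 * d) * (h * r) * n"
    using exists_lattice_crossing[of a b "\<lambda>s. half_coord d (g s) i" "1 / (64 * d) * (h * r)"]
      ab i(2) h0 r d by auto
  have sL: "0 \<le> s" "s \<le> L" using s abL by auto
  define w where "w = \<beta> * (h * r)"
  have w: "0 < w" "w \<le> h * r" using \<beta>0 \<beta>1 h0 r by (auto simp: w_def mult_le_cancel_right1)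
  \<comment> \<open>Coordinate \<open>i\<close> already lies on a wall and stays. The others are
    rounded upwards, so the height does not drop below \<open>h / 2\<close>.\<close>
  define e where "e = (\<lambda>j. if j = i then half_coord d (g s) i else w * \<lceil>half_coord d (g s) j / w\<rceil>)"
  have e: "half_coord d (g s) j \<le> e j" "e j \<le> half_coord d (g s) j + w" for j
  proof -
    show "half_coord d (g s) j \<le> e j" "e j \<le> half_coord d (g s) j + w"
      using round_up_bounds[OF w(1)] w by (auto simp: e_def)
  qed
  have lat: "\<exists>n::int. e j = fine_step d \<epsilon> R i j * (h * r) * n" for j
    using n by (auto simp: e_def fine_step_def w_def \<beta>_def r_def)
  have ed: "e d \<ge> h / 2" "e d > 0" using e[of d] zab[OF s] h0 by (auto simp: z_def)
  define q where "q = from_half d e"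
  have q: "q \<in> hyp_space d" using from_half_in[where e = e, OF d ed(2)] by (simp add: q_def)
  have qj: "half_coord d q j = e j" if "j \<in> {1..d}" for j
    unfolding q_def by (rule half_coord_from_half[where e = e, OF d ed(2) that])
  have gs: "g s \<in> hyp_space d" using g sL by simp
  have "- minkowski d (g s) q - 1 = (\<Sum>j=1..d. (half_coord d (g s) j - half_coord d q j)\<^sup>2) / (2 * z s * e d)"
    using minkowski_half_coord[OF gs q d] qj[of d] d by (simp add: z_def)
  also have "\<dots> \<le> (\<Sum>j=1..d. w\<^sup>2) / (2 * (h / 2) * (h / 2))"
  proof (rule frac_le)
    show "(\<Sum>j=1..d. (half_coord d (g s) j - half_coord d q j)\<^sup>2) \<le> (\<Sum>j=1..d. w\<^sup>2)"
    proof (rule sum_mono)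
      fix j assume "j \<in> {1..d}"
      then have "\<bar>half_coord d (g s) j - half_coord d q j\<bar> \<le> \<bar>w\<bar>"
        using e[of j] qj[of j] w by auto
      then show "(half_coord d (g s) j - half_coord d q j)\<^sup>2 \<le> w\<^sup>2"
        by (simp only: abs_le_square_iff)
    qed
    show "2 * (h / 2) * (h / 2) \<le> 2 * z s * e d"
      using zab[OF s] ed h0 by (intro mult_mono) auto
  qed (use h0 in \<open>auto simp: sum_nonneg\<close>)
  also have "\<dots> = 2 * d * \<beta>\<^sup>2 * r\<^sup>2"
    using h0 by (simp add: w_def power_mult_distrib field_simps power2_eq_square)
  finally have D: "- minkowski d (g s) q - 1 \<le> 2 * d * \<beta>\<^sup>2 * r\<^sup>2" .
  have "hdist d u q + hdist d q v \<le> L + (4 / \<rho>) * (- minkowski d (g s) q - 1)"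
    unfolding L_def g_def
    by (rule detour_le[OF u v d q]) (use \<rho> s ab in \<open>auto simp: L_def\<close>)
  also have "\<dots> \<le> L + (4 / \<rho>) * (2 * d * \<beta>\<^sup>2 * r\<^sup>2)"
    using D \<rho> by (intro add_left_mono mult_left_mono) auto
  also have "(4 / \<rho>) * (2 * d * \<beta>\<^sup>2 * r\<^sup>2) = \<epsilon> * R / 32"
    unfolding \<beta>2 \<rho>_def using r d by (simp add: field_simps power2_eq_square)
  finally have detour: "hdist d u q + hdist d q v \<le> hdist d u v + \<epsilon> * R / 32" by (simp add: L_def)
  \<comment> \<open>Stated for a generic end \<open>p\<close>. For \<open>R > 1\<close> heights are
    compared with 0 and horizontal offsets with \<open>4 * z s0 \<le> 8 * h\<close>; for
    \<open>R \<le> 1\<close> distance at most \<open>2 * R\<close> bounds every coordinate. Either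
    way 63 cells suffice, and rounding adds at most one.\<close>
  have window: "e j \<in> fine_set d \<epsilon> R p i k j"
    if j: "j \<in> {1..d}" and p: "p \<in> hyp_space d" and zp: "half_coord d p d \<le> 4 * z s0"
      and dp: "hdist d p (g s) \<le> 2 * R"
      and xp: "j \<noteq> d \<Longrightarrow> \<bar>half_coord d (g s) j - half_coord d p j\<bar> \<le> 4 * z s0" for j p
  proof -
    have "\<bar>half_coord d (g s) j - fine_centre d R p j\<bar> \<le> 63 * (h * r)"
    proof (cases "R > 1")
      case True
      then have "r = 1" by (simp add: r_def)
      moreover have "\<bar>half_coord d (g s) d\<bar> \<le> 4 * h"
        using zab[OF s] h0 by (auto simp: z_def)
      ultimately show ?thesis using True xp h h0 by (auto simp: fine_centre_def)
    next
      case False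
      then have rR: "r = R" by (simp add: r_def)
      define D where "D = hdist d p (g s)"
      have D: "0 \<le> D" "D \<le> 2" "D \<le> 2 * R"
        using hdist_nonneg[OF p gs d] dp False by (auto simp: D_def)
      have zp0: "half_coord d p d > 0" using height_pos[OF p d] .
      have "(half_coord d (g s) j - half_coord d p j)\<^sup>2
          \<le> 2 * z s * half_coord d p d * (cosh D - 1)"
        using coord_diff_sq_le[OF gs p d j] by (simp add: z_def D_def hdist_commute)
      also have "\<dots> \<le> 2 * (4 * h) * (8 * h) * (5 * (2 * R)\<^sup>2)"
      proof (intro mult_mono)
        have "cosh D - 1 \<le> 5 * D\<^sup>2" by (rule cosh_minus_one_le[OF D(1,2)])
        also have "D\<^sup>2 \<le> (2 * R)\<^sup>2" using D by (intro power_mono) auto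
        finally show "cosh D - 1 \<le> 5 * (2 * R)\<^sup>2" by simp
      qed (use zab[OF s] h0 h zp zp0 zpos[OF sL] cosh_real_ge_1[of D] in auto)
      also have "\<dots> \<le> (63 * (h * r))\<^sup>2"
        using R h0 by (simp add: rR power_mult_distrib power2_eq_square)
      finally have "\<bar>half_coord d (g s) j - half_coord d p j\<bar> \<le> \<bar>63 * (h * r)\<bar>"
        by (simp only: abs_le_square_iff)
      then show ?thesis using False h0 r by (simp add: fine_centre_def)
    qed
    then have "\<bar>e j - fine_centre d R p j\<bar> \<le> 64 * (h * r)"
      using e[of j] w by (auto simp: abs_le_iff)
    then show ?thesis using lat[of j] by (auto simp: fine_set_def lattice_interval_def h_def r_def)
  qed
  have Ls: "hdist d u v > 0" "0 \<le> s" "s \<le> hdist d u v" using L0 sL by (auto simp: L_def)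
  have between: "\<bar>half_coord d (g s) j - half_coord d u j\<bar> \<le> 4 * z s0"
     "\<bar>half_coord d (g s) j - half_coord d v j\<bar> \<le> 4 * z s0"
    if "j \<in> {1..d}" "j \<noteq> d" for j
    using coord_geod_between[OF u v d Ls(2,3,1), of j] that s0x[of j]
    by (auto simp: g_def intro: order_trans)
  have "q \<in> grid d (fine_set d \<epsilon> R u i k)" unfolding q_def
    using window[OF _ u s0(3)] between(1) du[of s] sL L
    by (intro from_half_in_grid d ed(2)) (auto simp: L_def)
  moreover have "q \<in> grid d (fine_set d \<epsilon> R v i k)" unfolding q_def
    using window[OF _ v s0(4)] between(2) dv[of s] sL L
    by (intro from_half_in_grid d ed(2)) (auto simp: L_def)
  ultimately show ?thesis using i(1) ku kv detour by blast
qed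

subsection \<open>The coarse grid\<close>

text \<open>Admissible heights form a geometric progression of ratio \<open>exp a\<close>. With
  \<open>a\<close> proportional to \<open>\<epsilon> * R\<close> only \<open>O(1/\<epsilon>)\<close>
  of them are visible from one point.\<close>

definition coarse_scales :: "nat \<Rightarrow> real \<Rightarrow> real \<Rightarrow> (nat \<Rightarrow> real) \<Rightarrow> int set" where
  "coarse_scales d a R u =
    {k. half_coord d u d \<le> exp (a * real_of_int k) \<and> exp (a * real_of_int k) \<le> exp (2 * R + 1 + a) * half_coord d u d}"

definition coarse_set :: "nat \<Rightarrow> real \<Rightarrow> (nat \<Rightarrow> real) \<Rightarrow> int \<Rightarrow> nat \<Rightarrow> real set" where
  "coarse_set d a u k j = (if j = d then {exp (a * real_of_int k)}
     else lattice_interval (exp (a * real_of_int k) / d) (half_coord d u j) (2 * exp (a * real_of_int k)))"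

text \<open>The 36 is the product of the constants 3, 6 and 2 that arise in the next lemma, and is
  the source of its additive error 4.\<close>

lemma exp_four_ge: "36 \<le> exp (4::real)"
proof -
  have "5 / 2 \<le> exp (1::real)" using exp_lower_Taylor_quadratic[of "1::real"] by simp
  then have "(5 / 2) ^ 4 \<le> exp (1::real) ^ 4" by (intro power_mono) auto
  also have "exp (1::real) ^ 4 = exp 4" by (simp flip: exp_of_nat_mult)
  finally show ?thesis by (simp add: power_divide)
qed

text \<open>At distances of order at least \<open>1/\<epsilon>\<close> a constant error is harmless, so it suffices to go up
  to a grid point above the top of the geodesic and down again.\<close>

lemma coarse_common_point:
  assumes u: "u \<in> hyp_space d" and v: "v \<in> hyp_space d" and d: "d \<ge> 1"
    and a: "0 < a" and L: "hdist d u v \<le> 2 * R"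
  shows "\<exists>k\<in>coarse_scales d a R u \<inter> coarse_scales d a R v.
    \<exists>q\<in>grid d (coarse_set d a u k) \<inter> grid d (coarse_set d a v k).
      hdist d u q + hdist d q v \<le> hdist d u v + 2 * a + 4"
proof -
  define L where "L = hdist d u v"
  define za where "za = half_coord d u d"
  define zb where "zb = half_coord d v d"
  have z: "za > 0" "zb > 0" using height_pos u v d by (auto simp: za_def zb_def)
  have L0: "L \<ge> 0" using hdist_nonneg[OF u v d] by (simp add: L_def)
  define S where "S = (\<Sum>j=1..<d. (half_coord d u j - half_coord d v j)\<^sup>2)"
  have S0: "S \<ge> 0" by (simp add: S_def sum_nonneg)
  define M where "M = sqrt (S + za\<^sup>2 + zb\<^sup>2)"
  have M2: "M\<^sup>2 = S + za\<^sup>2 + zb\<^sup>2" using S0 by (simp add: M_def)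
  have M0: "M > 0" using S0 z by (simp add: M_def add_nonneg_pos)
  have MM: "M\<^sup>2 = 2 * za * zb * cosh L"
    using extent_sq_eq[OF u v d] by (simp add: M2 S_def za_def zb_def L_def)
  have Mz: "za \<le> M" "zb \<le> M"
    by (rule power2_le_imp_le; use M0 M2 S0 in auto)+
  have coshL: "cosh L \<le> exp L" using L0 by (simp add: cosh_def)
  \<comment> \<open>\<open>M\<close> is the Euclidean size of the pair; \<open>k\<close> picks the
    first admissible height above it, which overshoots by a factor of at most
    \<open>exp a\<close>.\<close>
  define k where "k = \<lceil>ln M / a\<rceil>"
  define h where "h = exp (a * real_of_int k)"
  have h0: "h > 0" by (simp add: h_def)
  have "ln M \<le> a * k" "a * k \<le> ln M + a" using round_up_bounds[OF a, of "ln M"] by (auto simp: k_def)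
  then have "exp (ln M) \<le> h" "h \<le> exp (ln M + a)" by (auto simp: h_def)
  then have h: "M \<le> h" "h \<le> M * exp a" using M0 by (auto simp: exp_add)
  \<comment> \<open>Bounding the other height by \<open>exp L\<close> times that of \<open>p\<close>
    gives \<open>M \<le> 2 * exp L * half_coord d p d\<close>. Absorbing the 2 into
    \<open>exp 1\<close> explains the summand 1 in \<open>coarse_scales\<close>.\<close>
  have scale: "k \<in> coarse_scales d a R p"
    if le: "half_coord d p d \<le> M" and p: "half_coord d p d > 0"
      and sq: "M\<^sup>2 \<le> 2 * half_coord d p d * (exp L * half_coord d p d) * exp L" for p
  proof -
    have "M\<^sup>2 \<le> 2 * (exp L * half_coord d p d)\<^sup>2" using sq by (simp add: power2_eq_square mult_ac)
    also have "\<dots> \<le> 2\<^sup>2 * (exp L * half_coord d p d)\<^sup>2" by simp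
    finally have "M\<^sup>2 \<le> (2 * (exp L * half_coord d p d))\<^sup>2" by (simp only: power_mult_distrib)
    then have "M \<le> 2 * (exp L * half_coord d p d)"
      by (rule power2_le_imp_le) (use p in auto)
    also have "\<dots> \<le> exp 1 * (exp (2 * R) * half_coord d p d)"
      using p L exp_ge_add_one_self[of "1::real"] by (intro mult_mono) (auto simp: L_def)
    finally have "M * exp a \<le> exp 1 * (exp (2 * R) * half_coord d p d) * exp a"
      by (intro mult_right_mono) auto
    also have "\<dots> = exp (2 * R + 1 + a) * half_coord d p d"
      by (simp add: exp_add)
    finally have "h \<le> exp (2 * R + 1 + a) * half_coord d p d" using h by simp
    then show ?thesis using h le by (auto simp: coarse_scales_def h_def)
  qed
  have ba: "zb \<le> exp L * za" "za \<le> exp L * zb"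
    using height_le[OF v u d] height_le[OF u v d] by (auto simp: za_def zb_def L_def hdist_commute)
  have ku: "k \<in> coarse_scales d a R u"
  proof (rule scale)
    have "M\<^sup>2 \<le> 2 * za * (exp L * za) * exp L"
      unfolding MM using z ba coshL by (intro mult_mono) auto
    then show "M\<^sup>2 \<le> 2 * half_coord d u d * (exp L * half_coord d u d) * exp L" by (simp add: za_def)
  qed (use Mz z in \<open>auto simp: za_def\<close>)
  have kv: "k \<in> coarse_scales d a R v"
  proof (rule scale)
    have "M\<^sup>2 = 2 * zb * za * cosh L" unfolding MM by simp
    also have "\<dots> \<le> 2 * zb * (exp L * zb) * exp L"
      using z ba coshL by (intro mult_mono) auto
    finally show "M\<^sup>2 \<le> 2 * half_coord d v d * (exp L * half_coord d v d) * exp L" by (simp add: zb_def)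
  qed (use Mz z in \<open>auto simp: zb_def\<close>)
  define w where "w = h / d"
  have d0: "real d \<ge> 1" using d by simp
  have w: "0 < w" "w \<le> h" using h0 d0 by (auto simp: w_def field_simps)
  define e where "e = (\<lambda>j. if j = d then h else w * \<lceil>half_coord d u j / w\<rceil>)"
  define q where "q = from_half d e"
  have ed: "e d > 0" "e d = h" using h0 by (auto simp: e_def)
  have q: "q \<in> hyp_space d" using from_half_in[where e = e, OF d ed(1)] by (simp add: q_def)
  have qj: "half_coord d q j = e j" if "j \<in> {1..d}" for j
    unfolding q_def by (rule half_coord_from_half[where e = e, OF d ed(1) that])
  have eu: "\<bar>e j - half_coord d u j\<bar> \<le> w" if "j \<noteq> d" for j
    using round_up_bounds[OF w(1), of "half_coord d u j"] that by (auto simp: e_def abs_le_iff)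
  have uv: "\<bar>half_coord d u j - half_coord d v j\<bar> \<le> h" if "j \<in> {1..d}" "j \<noteq> d" for j
  proof -
    have "(half_coord d u j - half_coord d v j)\<^sup>2 \<le> S"
      unfolding S_def using that by (intro member_le_sum) auto
    also have "\<dots> \<le> M\<^sup>2" using M2 by simp
    finally have "\<bar>half_coord d u j - half_coord d v j\<bar> \<le> \<bar>M\<bar>" by (simp only: abs_le_square_iff)
    then show ?thesis using h M0 by simp
  qed
  have ev: "\<bar>e j - half_coord d v j\<bar> \<le> 2 * h" if "j \<in> {1..d}" "j \<noteq> d" for j
    using eu[OF that(2)] uv[OF that] w by linarith
  have lat: "\<exists>n::int. e j = h / d * n" if "j \<noteq> d" for j
    using that by (auto simp: e_def w_def)
  have qu: "q \<in> grid d (coarse_set d a u k)"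
    unfolding q_def
  proof (rule from_half_in_grid[where e = e, OF d ed(1)])
    fix j assume "j \<in> {1..d}"
    have "\<bar>e j - half_coord d u j\<bar> \<le> 2 * h" if "j \<noteq> d" using eu[OF that] w by linarith
    then show "e j \<in> coarse_set d a u k j"
      using lat ed by (auto simp: coarse_set_def lattice_interval_def h_def)
  qed
  have qv: "q \<in> grid d (coarse_set d a v k)"
    unfolding q_def
  proof (rule from_half_in_grid[where e = e, OF d ed(1)])
    fix j assume "j \<in> {1..d}"
    then show "e j \<in> coarse_set d a v k j"
      using lat ed ev by (auto simp: coarse_set_def lattice_interval_def h_def)
  qed
  \<comment> \<open>With lattice step \<open>h / d\<close> the rounding errors of all horizontal
    coordinates together stay below the height \<open>h\<close>.\<close>
  have sw: "(\<Sum>j=1..<d. w\<^sup>2) \<le> h\<^sup>2"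
  proof -
    have "(\<Sum>j=1..<d. w\<^sup>2) \<le> d * w\<^sup>2" by (simp add: mult_right_mono)
    also have "\<dots> = h\<^sup>2 / d" using d by (simp add: w_def power2_eq_square)
    also have "\<dots> \<le> h\<^sup>2" using d0 by (simp add: divide_le_eq mult_le_cancel_left1)
    finally show ?thesis .
  qed
  have hz: "za\<^sup>2 \<le> h\<^sup>2" "zb\<^sup>2 \<le> h\<^sup>2" using Mz h z by (auto intro!: power_mono)
  have Mh: "M\<^sup>2 \<le> h\<^sup>2" using h M0 by (intro power_mono) auto
  have SM: "S \<le> M\<^sup>2" using M2 by simp
  define D where "D = hdist d u q"
  define E where "E = hdist d q v"
  have coshD: "2 * za * h * cosh D \<le> 3 * h\<^sup>2"
  proof -
    have "(\<Sum>j=1..<d. (half_coord d u j - half_coord d q j)\<^sup>2) \<le> (\<Sum>j=1..<d. w\<^sup>2)"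
    proof (rule sum_mono)
      fix j assume "j \<in> {1..<d}"
      then have "\<bar>half_coord d u j - half_coord d q j\<bar> \<le> \<bar>w\<bar>"
        using eu[of j] qj[of j] w by auto
      then show "(half_coord d u j - half_coord d q j)\<^sup>2 \<le> w\<^sup>2" by (simp only: abs_le_square_iff)
    qed
    then show ?thesis
      using extent_sq_eq[OF u q d] qj[of d] ed d sw hz by (simp add: za_def D_def)
  qed
  have coshE: "2 * zb * h * cosh E \<le> 6 * h\<^sup>2"
  proof -
    have "(\<Sum>j=1..<d. (half_coord d q j - half_coord d v j)\<^sup>2)
        \<le> (\<Sum>j=1..<d. 2 * w\<^sup>2 + 2 * (half_coord d u j - half_coord d v j)\<^sup>2)"
    proof (rule sum_mono)
      fix j assume "j \<in> {1..<d}"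
      then have "\<bar>half_coord d q j - half_coord d u j\<bar> \<le> \<bar>w\<bar>"
        using eu[of j] qj[of j] w by auto
      then have "(half_coord d q j - half_coord d u j)\<^sup>2 \<le> w\<^sup>2" by (simp only: abs_le_square_iff)
      moreover have "(x + y)\<^sup>2 \<le> 2 * x\<^sup>2 + 2 * y\<^sup>2" for x y :: real
        using zero_le_power2[of "x - y"] by (simp add: power2_eq_square algebra_simps)
      from this[of "half_coord d q j - half_coord d u j" "half_coord d u j - half_coord d v j"]
      have "(half_coord d q j - half_coord d v j)\<^sup>2
        \<le> 2 * (half_coord d q j - half_coord d u j)\<^sup>2 + 2 * (half_coord d u j - half_coord d v j)\<^sup>2"
        by simp
      ultimately show "(half_coord d q j - half_coord d v j)\<^sup>2
          \<le> 2 * w\<^sup>2 + 2 * (half_coord d u j - half_coord d v j)\<^sup>2" by simp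
    qed
    also have "\<dots> = 2 * (\<Sum>j=1..<d. w\<^sup>2) + 2 * S"
      by (simp only: S_def sum.distrib sum_distrib_left)
    finally have "(\<Sum>j=1..<d. (half_coord d q j - half_coord d v j)\<^sup>2) \<le> 4 * h\<^sup>2"
      using sw SM Mh by linarith
    then show ?thesis
      using extent_sq_eq[OF q v d] qj[of d] ed d hz by (simp add: zb_def E_def mult_ac)
  qed
  have expcosh: "exp x \<le> 2 * cosh x" for x :: real by (simp add: cosh_def)
  have "exp D * za \<le> 3 * h"
  proof -
    have "h * (exp D * za) \<le> h * (2 * cosh D * za)"
      using expcosh[of D] z h0 by (intro mult_left_mono mult_right_mono) auto
    also have "\<dots> \<le> h * (3 * h)" using coshD by (simp add: power2_eq_square mult_ac)
    finally show ?thesis using h0 by (simp only: mult_le_cancel_left_pos)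
  qed
  moreover have "exp E * zb \<le> 6 * h"
  proof -
    have "h * (exp E * zb) \<le> h * (2 * cosh E * zb)"
      using expcosh[of E] z h0 by (intro mult_left_mono mult_right_mono) auto
    also have "\<dots> \<le> h * (6 * h)" using coshE by (simp add: power2_eq_square mult_ac)
    finally show ?thesis using h0 by (simp only: mult_le_cancel_left_pos)
  qed
  \<comment> \<open>The two legs are multiplied rather than bounded separately: the heights
    \<open>za\<close> and \<open>zb\<close> then cancel against
    \<open>M^2 = 2 * za * zb * cosh L\<close>.\<close>
  ultimately have "(exp D * za) * (exp E * zb) \<le> (3 * h) * (6 * h)"
    by (rule mult_mono) (use z h0 in auto)
  also have "\<dots> = 18 * h\<^sup>2" by (simp add: power2_eq_square)
  also have "\<dots> \<le> 18 * (M * exp a)\<^sup>2" using h h0 by (intro mult_left_mono power_mono) auto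
  also have "\<dots> = 36 * (za * zb) * cosh L * (exp a)\<^sup>2"
    using MM by (simp add: power_mult_distrib)
  also have "\<dots> \<le> exp 4 * (za * zb) * exp L * (exp a)\<^sup>2"
    using exp_four_ge coshL z by (intro mult_mono) auto
  finally have "(za * zb) * exp (D + E) \<le> (za * zb) * exp (L + 2 * a + 4)"
    using exp_double[of a] by (simp add: exp_add mult_ac)
  then have "exp (D + E) \<le> exp (L + 2 * a + 4)" using z by (simp only: mult_le_cancel_left_pos mult_pos_pos)
  then have "D + E \<le> L + 2 * a + 4" by simp
  then show ?thesis using ku kv qu qv unfolding D_def E_def L_def by blast
qed

subsection \<open>Counting\<close>

lemma card_fine_scales:
  assumes "u \<in> hyp_space d" "d \<ge> 1" "R > 0"
  shows "finite (fine_scales d R u)" "real (card (fine_scales d R u)) \<le> 4 + 3 * R"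
proof -
  define z where "z = half_coord d u d"
  have z: "z > 0" using height_pos assms by (simp add: z_def)
  define a where "a = log 2 (z / 8)"
  define b where "b = log 2 (exp (2 * R) * z)"
  have e: "fine_scales d R u = {k::int. a \<le> k \<and> k \<le> b}"
    using z by (auto simp: fine_scales_def a_def b_def z_def[symmetric] log_le_iff le_log_iff)
  have l8: "log 2 8 = (3::real)"
    using log_pow_cancel[of "2::real" 3] by simp
  have ba: "b - a = 2 * R / ln 2 + 3"
    using z l8 by (simp add: a_def b_def log_mult log_divide)
  have "2 * R / ln 2 \<le> 2 * R / (2 / 3)"
    using ln2_ge_two_thirds assms by (intro divide_left_mono) auto
  then have ba': "b - a \<le> 3 + 3 * R" unfolding ba by simp
  have "a \<le> b" using ba assms by (smt (verit) divide_nonneg_nonneg ln_2_less_1 ln_gt_zero)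
  from card_int_interval_le[OF this] show "finite (fine_scales d R u)"
    "real (card (fine_scales d R u)) \<le> 4 + 3 * R"
    unfolding e using ba' by auto
qed

lemma card_coarse_scales:
  assumes "u \<in> hyp_space d" "d \<ge> 1" "R > 0" "a > 0"
  shows "finite (coarse_scales d a R u)"
    "real (card (coarse_scales d a R u)) \<le> (2 * R + 1 + a) / a + 1"
proof -
  define z where "z = half_coord d u d"
  have z: "z > 0" using height_pos assms by (simp add: z_def)
  have e: "coarse_scales d a R u = {k::int. ln z / a \<le> k \<and> k \<le> (2 * R + 1 + a + ln z) / a}"
  proof -
    have "z \<le> exp (a * real_of_int k) \<longleftrightarrow> ln z / a \<le> k" for k :: int
    proof -
      have "z \<le> exp (a * real_of_int k) \<longleftrightarrow> ln z \<le> a * real_of_int k"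
        using z exp_le_cancel_iff[of "ln z" "a * real_of_int k"] by simp
      then show ?thesis using assms(4) by (simp add: divide_le_eq mult.commute)
    qed
    moreover have "exp (a * real_of_int k) \<le> exp (2 * R + 1 + a) * z \<longleftrightarrow> k \<le> (2 * R + 1 + a + ln z) / a" for k :: int
    proof -
      have "exp (2 * R + 1 + a) * z = exp (2 * R + 1 + a + ln z)" using z by (simp add: exp_add)
      then show ?thesis using assms(4) by (simp add: le_divide_eq mult.commute)
    qed
    ultimately show ?thesis by (auto simp: coarse_scales_def z_def[symmetric])
  qed
  have "ln z / a \<le> (2 * R + 1 + a + ln z) / a" using assms by (intro divide_right_mono) auto
  from card_int_interval_le[OF this] show "finite (coarse_scales d a R u)"
    "real (card (coarse_scales d a R u)) \<le> (2 * R + 1 + a) / a + 1"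
    unfolding e by (auto simp: add_divide_distrib)
qed

text \<open>Window width and steps scale alike, so the count does not depend on \<open>k\<close>.
  The wall coordinate contributes a factor linear in \<open>d\<close> and free of \<epsilon>; only
  \<open>d - 1\<close> coordinates pay for the fine spacing.\<close>

lemma card_fine_grid:
  assumes d: "d \<ge> 1" and pos: "\<epsilon> > 0" "R > 0" and i: "i \<in> {1..d}"
  shows "finite (grid d (fine_set d \<epsilon> R u i k))"
    "real (card (grid d (fine_set d \<epsilon> R u i k)))
      \<le> (8192 * real d + 1) * (16384 * sqrt (real d * min R 1 / (\<epsilon> * R)) + 1) ^ (d - 1)"
proof -
  define c where "c = 2 powr k * min R 1"
  have c: "c > 0" using pos by (simp add: c_def)
  have st: "fine_step d \<epsilon> R i j > 0" for j using d pos by (simp add: fine_step_def)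
  define B where "B = (\<lambda>j. 2 * 64 / fine_step d \<epsilon> R i j + 1)"
  have A: "finite (fine_set d \<epsilon> R u i k j)" "real (card (fine_set d \<epsilon> R u i k j)) \<le> B j" for j
    using card_lattice_interval[of "fine_step d \<epsilon> R i j * c" "64 * c"] c st[of j]
    unfolding fine_set_def c_def[symmetric] B_def by auto
  show "finite (grid d (fine_set d \<epsilon> R u i k))" using A by (intro card_grid)
  have "real (card (grid d (fine_set d \<epsilon> R u i k))) \<le> real (\<Prod>j\<in>{1..d}. card (fine_set d \<epsilon> R u i k j))"
    using card_grid(2)[of d "fine_set d \<epsilon> R u i k"] A(1) by (simp only: of_nat_le_iff)
  also have "\<dots> = (\<Prod>j\<in>{1..d}. real (card (fine_set d \<epsilon> R u i k j)))" by simp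
  also have "\<dots> \<le> (\<Prod>j\<in>{1..d}. B j)" using A(2) by (intro prod_mono) auto
  also have "\<dots> = B i * (\<Prod>j\<in>{1..d} - {i}. B j)" using i by (intro prod.remove) auto
  also have "(\<Prod>j\<in>{1..d} - {i}. B j)
      = (\<Prod>j\<in>{1..d} - {i}. 16384 * sqrt (real d * min R 1 / (\<epsilon> * R)) + 1)"
  proof (rule prod.cong)
    fix j assume "j \<in> {1..d} - {i}"
    then have "B j = 16384 / sqrt (\<epsilon> * R / (d * min R 1)) + 1" by (simp add: B_def fine_step_def)
    also have "\<dots> = 16384 * sqrt (real d * min R 1 / (\<epsilon> * R)) + 1" by (simp add: real_sqrt_divide)
    finally show "B j = 16384 * sqrt (real d * min R 1 / (\<epsilon> * R)) + 1" .
  qed simp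
  also have "\<dots> = (16384 * sqrt (real d * min R 1 / (\<epsilon> * R)) + 1) ^ (d - 1)"
    using i by (simp add: card_Diff_singleton)
  also have "B i = 8192 * real d + 1" by (simp add: B_def fine_step_def)
  finally show "real (card (grid d (fine_set d \<epsilon> R u i k)))
      \<le> (8192 * real d + 1) * (16384 * sqrt (real d * min R 1 / (\<epsilon> * R)) + 1) ^ (d - 1)" .
qed

lemma card_coarse_grid:
  assumes d: "d \<ge> 1"
  shows "finite (grid d (coarse_set d a u k))"
    "real (card (grid d (coarse_set d a u k))) \<le> (5 * real d) ^ (d - 1)"
proof -
  have h: "exp (a * real_of_int k) > 0" by simp
  have A: "finite (coarse_set d a u k j)" "real (card (coarse_set d a u k j)) \<le> (if j = d then 1 else 5 * real d)" for j
  proof -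
    have "4 * real d + 1 \<le> 5 * d" using d by simp
    then show "finite (coarse_set d a u k j)" "real (card (coarse_set d a u k j)) \<le> (if j = d then 1 else 5 * real d)"
      using card_lattice_interval[of "exp (a * real_of_int k) / d" "2 * exp (a * real_of_int k)" "half_coord d u j"] d
      by (auto simp: coarse_set_def)
  qed
  show "finite (grid d (coarse_set d a u k))" using A by (intro card_grid)
  have "real (card (grid d (coarse_set d a u k))) \<le> real (\<Prod>j\<in>{1..d}. card (coarse_set d a u k j))"
    using card_grid(2)[of d "coarse_set d a u k"] A(1) by (simp only: of_nat_le_iff)
  also have "\<dots> = (\<Prod>j\<in>{1..d}. real (card (coarse_set d a u k j)))" by simp
  also have "\<dots> \<le> (\<Prod>j\<in>{1..d}. if j = d then 1 else 5 * real d)"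
    using A(2) by (intro prod_mono) auto
  also have "\<dots> = (\<Prod>j\<in>{1..d} - {d}. if j = d then 1 else 5 * real d)"
    using d prod.remove[of "{1..d}" d "\<lambda>j. if j = d then 1 else 5 * real d"] by simp
  also have "\<dots> = (\<Prod>j\<in>{1..d} - {d}. 5 * real d)" by (intro prod.cong) auto
  also have "\<dots> = (5 * real d) ^ (d - 1)" using d by (simp add: card_Diff_singleton)
  finally show "real (card (grid d (coarse_set d a u k))) \<le> (5 * real d) ^ (d - 1)" .
qed

subsection \<open>The Steiner points seen from a point at one scale\<close>

text \<open>A bound for all scales \<open>R\<close> at once. The plane is exceptional: there the
  number of visible heights grows with \<open>R\<close> faster than the grids shrink, and
  \<open>R\<close> of order \<open>1/\<epsilon>\<close> gives \<open>1/\<epsilon>\<close> instead of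
  \<open>1 / sqrt \<epsilon>\<close>.\<close>

definition steiner_growth :: "nat \<Rightarrow> real \<Rightarrow> real" where
  "steiner_growth d \<epsilon> = (if d = 2 then 1 / \<epsilon> else (1 / sqrt \<epsilon>) ^ (d - 1))"

lemma inverse_le_steiner_growth:
  assumes "d \<ge> 2" "0 < \<epsilon>" "\<epsilon> \<le> 1"
  shows "1 / \<epsilon> \<le> steiner_growth d \<epsilon>"
proof (cases "d = 2")
  case False
  have "1 / \<epsilon> = (1 / sqrt \<epsilon>) ^ 2" using assms by (simp add: power_divide)
  also have "\<dots> \<le> (1 / sqrt \<epsilon>) ^ (d - 1)"
    using assms False by (intro power_increasing) auto
  finally show ?thesis using False by (simp add: steiner_growth_def)
qed (simp add: steiner_growth_def)

text \<open>For \<open>R \<ge> 1\<close> the key relation is \<open>y^2 * R = 1/\<epsilon>\<close>.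
  If \<open>d \<ge> 3\<close>, two factors \<open>y\<close> pay for \<open>R\<close>. If
  \<open>d = 2\<close>, only \<open>(R * y)^2 = R/\<epsilon>\<close> is available, and the bound on
  \<open>\<epsilon> * R\<close> finishes.\<close>

lemma fine_count_le:
  assumes d: "d \<ge> 2" and \<epsilon>: "0 < \<epsilon>" "\<epsilon> \<le> 1" and R: "0 < R" "\<epsilon> * R \<le> 256"
  shows "(4 + 3 * R) * sqrt (min R 1 / (\<epsilon> * R)) ^ (d - 1) \<le> 112 * steiner_growth d \<epsilon>"
proof -
  define x where "x = 1 / sqrt \<epsilon>"
  define y where "y = sqrt (min R 1 / (\<epsilon> * R))"
  have x1: "x \<ge> 1" using \<epsilon> by (simp add: x_def)
  have x2: "x\<^sup>2 = 1 / \<epsilon>" using \<epsilon> by (simp add: x_def power_divide)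
  have y0: "y > 0" using R \<epsilon> by (simp add: y_def)
  have G: "steiner_growth d \<epsilon> = (if d = 2 then x\<^sup>2 else x ^ (d - 1))"
    unfolding x2 by (simp add: steiner_growth_def x_def)
  have "(4 + 3 * R) * y ^ (d - 1) \<le> 112 * steiner_growth d \<epsilon>"
  proof (cases "R \<le> 1")
    case True
    then have yx: "y = x" using R by (simp add: y_def x_def real_sqrt_divide)
    have "x ^ (d - 1) \<le> steiner_growth d \<epsilon>"
      unfolding G using x1 by (auto simp: power2_eq_square)
    moreover have "(4 + 3 * R) * x ^ (d - 1) \<le> 112 * x ^ (d - 1)"
      using True x1 by (intro mult_right_mono) auto
    ultimately show ?thesis unfolding yx by linarith
  next
    case False
    then have R1: "R \<ge> 1" by simp
    have yR: "y\<^sup>2 * R = x\<^sup>2" using R1 \<epsilon> by (simp add: y_def x2)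
    have yx: "y \<le> x"
    proof (rule power2_le_imp_le)
      have "y\<^sup>2 * 1 \<le> y\<^sup>2 * R" using R1 by (intro mult_left_mono) auto
      then show "y\<^sup>2 \<le> x\<^sup>2" using yR by simp
    qed (use x1 in auto)
    have "(4 + 3 * R) * y ^ (d - 1) \<le> (7 * R) * y ^ (d - 1)"
      using R1 y0 by (intro mult_right_mono) auto
    then have "(4 + 3 * R) * y ^ (d - 1) \<le> 7 * (R * y ^ (d - 1))" by (simp only: mult.assoc)
    also have "R * y ^ (d - 1) \<le> 16 * steiner_growth d \<epsilon>"
    proof (cases "d = 2")
      case True
      have "R * y \<le> 16 * x\<^sup>2"
      proof (rule power2_le_imp_le)
        have "(R * y)\<^sup>2 = R * (y\<^sup>2 * R)" by (simp add: power2_eq_square)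
        also have "\<dots> = R * x\<^sup>2" by (simp only: yR)
        also have "\<dots> \<le> (256 * x\<^sup>2) * x\<^sup>2"
          using R \<epsilon> by (intro mult_right_mono) (auto simp: x2 field_simps)
        finally show "(R * y)\<^sup>2 \<le> (16 * x\<^sup>2)\<^sup>2" by (simp add: power2_eq_square)
      qed (use x1 in auto)
      then show ?thesis unfolding G using True by simp
    next
      case False
      then have e: "d - 1 = 2 + (d - 3)" using d by simp
      have "R * y ^ (d - 1) = (y\<^sup>2 * R) * y ^ (d - 3)" unfolding e power_add by simp
      also have "\<dots> \<le> x\<^sup>2 * x ^ (d - 3)"
        unfolding yR using yx y0 by (intro mult_left_mono power_mono) auto
      also have "\<dots> = x ^ (d - 1)" unfolding e power_add by simp
      also have "\<dots> \<le> 16 * x ^ (d - 1)" using x1 by simp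
      finally show ?thesis unfolding G using False by simp
    qed
    finally show ?thesis by simp
  qed
  then show ?thesis by (simp add: y_def)
qed

lemma card_UN_le_mult:
  assumes "finite A" "real (card A) \<le> a" "\<And>x. x \<in> A \<Longrightarrow> finite (F x)"
    "\<And>x. x \<in> A \<Longrightarrow> real (card (F x)) \<le> b" "b \<ge> 0"
  shows "real (card (\<Union>x\<in>A. F x)) \<le> a * b"
proof -
  have "real (card (\<Union>x\<in>A. F x)) \<le> (\<Sum>x\<in>A. real (card (F x)))"
    using card_UN_le[OF assms(1), of F] by (metis of_nat_le_iff of_nat_sum)
  also have "\<dots> \<le> (\<Sum>x\<in>A. b)" using assms by (intro sum_mono) auto
  also have "\<dots> \<le> a * b" using assms by (simp add: mult_right_mono)
  finally show ?thesis .
qed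

lemma fine_steiner_system:
  assumes d: "d \<ge> 2" and \<epsilon>: "0 < \<epsilon>" "\<epsilon> \<le> 1" and R: "0 < R" "\<epsilon> * R \<le> 256"
  defines "S \<equiv> \<lambda>u. \<Union>k\<in>fine_scales d R u. \<Union>i\<in>{1..d}. grid d (fine_set d \<epsilon> R u i k)"
  assumes u: "u \<in> hyp_space d"
  shows "finite (S u)" "S u \<subseteq> hyp_space d"
    "real (card (S u)) \<le> (10 ^ 6 * real d) ^ (d + 1) * steiner_growth d \<epsilon>"
proof -
  have d1: "d \<ge> 1" using d by simp
  define y where "y = sqrt (min R 1 / (\<epsilon> * R))"
  show "S u \<subseteq> hyp_space d" unfolding S_def using grid_subset[OF d1] by blast
  show "finite (S u)" unfolding S_def
    using card_fine_scales(1)[OF u d1] card_fine_grid(1)[OF d1] R \<epsilon> by auto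
  \<comment> \<open>The lower bound allows the summand 1 of each lattice count to be absorbed into
    \<open>16 * (real d * y)\<close>, which turns 16384 into 16400.\<close>
  have y16: "1 / 16 \<le> y"
  proof -
    have "\<epsilon> * R \<le> 256 * min R 1"
      using R \<epsilon> by (cases "R \<le> 1") (auto intro: mult_right_mono)
    then have "(1 / 16)\<^sup>2 \<le> min R 1 / (\<epsilon> * R)" using R \<epsilon> by (simp add: field_simps power2_eq_square)
    then show ?thesis unfolding y_def by (rule real_le_rsqrt)
  qed
  define B where "B = (8192 * real d + 1) * (16384 * sqrt (real d * min R 1 / (\<epsilon> * R)) + 1) ^ (d - 1)"
  have B0: "B \<ge> 0" unfolding B_def using R \<epsilon> by simp
  have "real (card (S u)) \<le> (4 + 3 * R) * (real d * B)"
    unfolding S_def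
  proof (rule card_UN_le_mult)
    fix k assume "k \<in> fine_scales d R u"
    show "finite (\<Union>i\<in>{1..d}. grid d (fine_set d \<epsilon> R u i k))"
      using card_fine_grid(1)[OF d1] R \<epsilon> by auto
    show "real (card (\<Union>i\<in>{1..d}. grid d (fine_set d \<epsilon> R u i k))) \<le> real d * B"
      by (rule card_UN_le_mult) (use card_fine_grid[OF d1 \<epsilon>(1) R(1)] B0 in \<open>auto simp: B_def\<close>)
  qed (use card_fine_scales[OF u d1] R B0 in auto)
  also have "B \<le> (8193 * real d) * (16400 * real d * y) ^ (d - 1)"
    unfolding B_def
  proof (rule mult_mono)
    show "(16384 * sqrt (real d * min R 1 / (\<epsilon> * R)) + 1) ^ (d - 1) \<le> (16400 * real d * y) ^ (d - 1)"
    proof (rule power_mono)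
      have "sqrt (real d * min R 1 / (\<epsilon> * R)) = sqrt (real d) * y"
        unfolding y_def by (simp flip: real_sqrt_mult)
      also have "\<dots> \<le> real d * y"
        using d y16 by (intro mult_right_mono real_le_lsqrt) (auto simp: power2_eq_square)
      finally have "sqrt (real d * min R 1 / (\<epsilon> * R)) \<le> real d * y" .
      moreover have "1 \<le> 16 * (real d * y)"
        using mult_mono[of 1 "real d" "1/16" y] d y16 by simp
      ultimately show "16384 * sqrt (real d * min R 1 / (\<epsilon> * R)) + 1 \<le> 16400 * real d * y" by simp
    qed (use R \<epsilon> in auto)
  qed (use d R \<epsilon> in auto)
  then have "(4 + 3 * R) * (real d * B)
      \<le> (4 + 3 * R) * (real d * ((8193 * real d) * (16400 * real d * y) ^ (d - 1)))"
    using R by (intro mult_left_mono) auto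
  also have "\<dots> = 8193 * (real d)\<^sup>2 * (16400 * real d) ^ (d - 1) * ((4 + 3 * R) * y ^ (d - 1))"
    by (simp add: power_mult_distrib power2_eq_square)
  also have "\<dots> \<le> 8193 * (real d)\<^sup>2 * (16400 * real d) ^ (d - 1) * (112 * steiner_growth d \<epsilon>)"
    using fine_count_le[OF d \<epsilon> R] by (intro mult_left_mono) (auto simp: y_def)
  also have "\<dots> = (917616 * (real d)\<^sup>2 * (16400 * real d) ^ (d - 1)) * steiner_growth d \<epsilon>" by simp
  also have "\<dots> \<le> ((10 ^ 6 * real d)\<^sup>2 * (10 ^ 6 * real d) ^ (d - 1)) * steiner_growth d \<epsilon>"
    using \<epsilon> by (intro mult_right_mono mult_mono power_mono)
      (auto simp: power_mult_distrib steiner_growth_def)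
  also have "(10 ^ 6 * real d)\<^sup>2 * (10 ^ 6 * real d) ^ (d - 1) = (10 ^ 6 * real d) ^ (d + 1)"
  proof -
    have "2 + (d - 1) = d + 1" using d by simp
    then show ?thesis by (metis power_add)
  qed
  finally show "real (card (S u)) \<le> (10 ^ 6 * real d) ^ (d + 1) * steiner_growth d \<epsilon>" .
qed

lemma coarse_steiner_system:
  assumes d: "d \<ge> 2" and \<epsilon>: "0 < \<epsilon>" "\<epsilon> \<le> 1 / 2" and R: "\<epsilon> * R \<ge> 256"
  defines "a \<equiv> \<epsilon> * R / 128"
  defines "S \<equiv> \<lambda>u. \<Union>k\<in>coarse_scales d a R u. grid d (coarse_set d a u k)"
  assumes u: "u \<in> hyp_space d"
  shows "finite (S u)" "S u \<subseteq> hyp_space d"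
    "real (card (S u)) \<le> (10 ^ 6 * real d) ^ (d + 1) * steiner_growth d \<epsilon>"
proof -
  have d1: "d \<ge> 1" using d by simp
  have R0: "R \<ge> 1"
  proof (rule ccontr)
    assume "\<not> R \<ge> 1"
    then have "\<epsilon> * R \<le> \<epsilon> * 1" using \<epsilon> by (intro mult_left_mono) auto
    then show False using R \<epsilon> by linarith
  qed
  have a: "a > 0" using R by (simp add: a_def)
  show "S u \<subseteq> hyp_space d" unfolding S_def using grid_subset[OF d1] by blast
  show "finite (S u)" unfolding S_def
    using card_coarse_scales(1)[OF u d1] card_coarse_grid(1)[OF d1] R0 a by auto
  have "real (card (S u)) \<le> ((2 * R + 1 + a) / a + 1) * (5 * real d) ^ (d - 1)"
    unfolding S_def
    by (rule card_UN_le_mult) (use card_coarse_scales[OF u d1] card_coarse_grid[OF d1] R0 a in auto)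
  also have "(2 * R + 1 + a) / a + 1 \<le> 385 * (1 / \<epsilon>)"
  proof -
    have "(2 * R + 1 + a) / a + 1 = (2 * R + 1) / a + 2" using a by (simp add: add_divide_distrib)
    also have "(2 * R + 1) / a \<le> (3 * R) / a" using R0 a by (intro divide_right_mono) auto
    also have "(3 * R) / a = 384 / \<epsilon>" using R0 \<epsilon> by (simp add: a_def)
    also have "384 / \<epsilon> + 2 \<le> 385 * (1 / \<epsilon>)" using \<epsilon> by (simp add: field_simps)
    finally show ?thesis by simp
  qed
  also have "385 * (1 / \<epsilon>) * (5 * real d) ^ (d - 1)
      \<le> (10 ^ 6 * real d)\<^sup>2 * steiner_growth d \<epsilon> * (10 ^ 6 * real d) ^ (d - 1)"
  proof (intro mult_mono power_mono inverse_le_steiner_growth)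
    have "(10 ^ 6)\<^sup>2 * 1 \<le> (10 ^ 6)\<^sup>2 * (real d)\<^sup>2"
      using d by (intro mult_left_mono) auto
    then show "385 \<le> (10 ^ 6 * real d)\<^sup>2" by (simp add: power_mult_distrib)
  qed (use d \<epsilon> in \<open>auto simp: steiner_growth_def\<close>)
  also have "\<dots> = (10 ^ 6 * real d) ^ (2 + (d - 1)) * steiner_growth d \<epsilon>"
    by (simp only: power_add mult_ac)
  also have "2 + (d - 1) = d + 1" using d by simp
  finally show "real (card (S u)) \<le> (10 ^ 6 * real d) ^ (d + 1) * steiner_growth d \<epsilon>"
    by (simp add: mult_right_mono)
qed

text \<open>Grid points may hit \<open>P\<close>, but Steiner points must not. Shifting coordinate
  1, which is not the height as \<open>d \<ge> 2\<close>, by up to \<open>z * t\<close> yields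
  infinitely many points within distance \<open>t\<close>.\<close>

lemma exists_near_point_avoiding:
  assumes q: "q \<in> hyp_space d" and d: "d \<ge> 2" and P: "finite P" and t: "t > 0"
  shows "\<exists>q'\<in>hyp_space d - P. hdist d q q' \<le> t"
proof -
  have d1: "d \<ge> 1" using d by simp
  define z where "z = half_coord d q d"
  have z: "z > 0" using height_pos[OF q d1] by (simp add: z_def)
  define f where "f = (\<lambda>x. from_half d ((half_coord d q)(1 := half_coord d q 1 + x)))"
  have ed: "((half_coord d q)(1 := half_coord d q 1 + x)) d > 0" for x
    using z d by (simp add: z_def)
  have f: "f x \<in> hyp_space d" for x
    unfolding f_def by (rule from_half_in[where e = "(half_coord d q)(1 := half_coord d q 1 + x)", OF d1 ed])
  have fj: "half_coord d (f x) j = ((half_coord d q)(1 := half_coord d q 1 + x)) j" if "j \<in> {1..d}" for x j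
    unfolding f_def
    by (rule half_coord_from_half[where e = "(half_coord d q)(1 := half_coord d q 1 + x)", OF d1 ed that])
  have "inj f"
  proof (rule injI)
    fix x y assume "f x = f y"
    then have "half_coord d (f x) 1 = half_coord d (f y) 1" by simp
    then show "x = y" using fj[of 1] d by simp
  qed
  moreover have "infinite {0..z * t}" using z t by (simp add: infinite_Icc)
  ultimately have "infinite (f ` {0..z * t})" by (metis finite_imageD inj_on_subset subset_UNIV)
  then have "\<not> f ` {0..z * t} \<subseteq> P" using P finite_subset by blast
  then obtain x where x: "0 \<le> x" "x \<le> z * t" "f x \<notin> P" by (auto simp: subset_iff)
  have "- minkowski d q (f x) = 1 + (\<Sum>j=1..d. (if j = 1 then x\<^sup>2 else 0)) / (2 * z * z)"
  proof -
    have "(\<Sum>j=1..d. (half_coord d q j - half_coord d (f x) j)\<^sup>2) = (\<Sum>j=1..d. (if j = 1 then x\<^sup>2 else 0))"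
      by (intro sum.cong) (auto simp: fj)
    then show ?thesis
      using minkowski_half_coord[OF q f d1, of x] fj[of d x] d by (simp add: z_def)
  qed
  also have "(\<Sum>j=1..d. (if j = 1 then x\<^sup>2 else 0)) = x\<^sup>2" using d by (subst sum.delta) auto
  also have "1 + x\<^sup>2 / (2 * z * z) \<le> 1 + (z * t)\<^sup>2 / (2 * z * z)"
    using x z by (intro add_left_mono divide_right_mono power_mono) auto
  also have "\<dots> = 1 + t\<^sup>2 / 2" using z by (simp add: power2_eq_square)
  also have "\<dots> \<le> cosh t" using cosh_minus_one_ge[of t] t by simp
  finally have "hdist d q (f x) \<le> t" using hdist_le_iff[OF q f d1, of t] t by simp
  then show ?thesis using f x by blast
qed

text \<open>Both grids are displaced off \<open>P\<close> by one map \<phi> on points, so a common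
  grid point remains common. Its detour grows from \<open>\<epsilon> * R / 32\<close> by two
  displacements of \<open>\<epsilon> * R / 64\<close>.\<close>

lemma exists_steiner_system:
  assumes d: "d \<ge> 2" and \<epsilon>: "0 < \<epsilon>" "\<epsilon> \<le> 1 / 2" and R: "0 < R" and P: "finite P"
  shows "\<exists>S. (\<forall>u\<in>hyp_space d. finite (S u) \<and> S u \<subseteq> hyp_space d - P \<and>
        real (card (S u)) \<le> (10 ^ 6 * real d) ^ (d + 1) * steiner_growth d \<epsilon>) \<and>
      (\<forall>u\<in>hyp_space d. \<forall>v\<in>hyp_space d. R / 16 \<le> hdist d u v \<longrightarrow> hdist d u v \<le> 2 * R \<longrightarrow>
        (\<exists>q\<in>S u \<inter> S v. hdist d u q + hdist d q v \<le> hdist d u v + \<epsilon> * R / 16))"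
proof -
  have d1: "d \<ge> 1" using d by simp
  obtain S where S: "\<And>u. u \<in> hyp_space d \<Longrightarrow> finite (S u)" "\<And>u. u \<in> hyp_space d \<Longrightarrow> S u \<subseteq> hyp_space d"
      "\<And>u. u \<in> hyp_space d \<Longrightarrow> real (card (S u)) \<le> (10 ^ 6 * real d) ^ (d + 1) * steiner_growth d \<epsilon>"
    and Sq: "\<And>u v. u \<in> hyp_space d \<Longrightarrow> v \<in> hyp_space d \<Longrightarrow> R / 16 \<le> hdist d u v \<Longrightarrow> hdist d u v \<le> 2 * R
      \<Longrightarrow> \<exists>q\<in>S u \<inter> S v. hdist d u q + hdist d q v \<le> hdist d u v + \<epsilon> * R / 32"
  proof (cases "\<epsilon> * R \<le> 256")
    case True
    have \<epsilon>1: "\<epsilon> \<le> 1" using \<epsilon> by simp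
    define S where "S = (\<lambda>u. \<Union>k\<in>fine_scales d R u. \<Union>i\<in>{1..d}. grid d (fine_set d \<epsilon> R u i k))"
    show thesis
    proof (rule that[of S])
      fix u v assume uv: "u \<in> hyp_space d" "v \<in> hyp_space d" "R / 16 \<le> hdist d u v" "hdist d u v \<le> 2 * R"
      from fine_common_point[OF uv(1,2) d1 \<epsilon>(1) \<epsilon>1 R True uv(3,4)]
      obtain i k q where "i \<in> {1..d}" "k \<in> fine_scales d R u" "k \<in> fine_scales d R v"
        "q \<in> grid d (fine_set d \<epsilon> R u i k)" "q \<in> grid d (fine_set d \<epsilon> R v i k)"
        "hdist d u q + hdist d q v \<le> hdist d u v + \<epsilon> * R / 32" by blast
      then show "\<exists>q\<in>S u \<inter> S v. hdist d u q + hdist d q v \<le> hdist d u v + \<epsilon> * R / 32"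
        unfolding S_def by (intro bexI[of _ q]) blast+
    qed (use fine_steiner_system[OF d \<epsilon>(1) \<epsilon>1 R True] in \<open>simp_all add: S_def\<close>)
  next
    case False
    then have eR: "\<epsilon> * R \<ge> 256" by simp
    define a where "a = \<epsilon> * R / 128"
    \<comment> \<open>The threshold 256 is what makes the constant 4 at most
      \<open>\<epsilon> * R / 64\<close>; the summand \<open>2 * a\<close> takes the other
      half.\<close>
    have a: "a > 0" "2 * a + 4 \<le> \<epsilon> * R / 32" unfolding a_def using eR by linarith+
    define S where "S = (\<lambda>u. \<Union>k\<in>coarse_scales d a R u. grid d (coarse_set d a u k))"
    show thesis
    proof (rule that[of S])
      fix u v assume uv: "u \<in> hyp_space d" "v \<in> hyp_space d" "R / 16 \<le> hdist d u v" "hdist d u v \<le> 2 * R"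
      from coarse_common_point[OF uv(1,2) d1 a(1) uv(4)]
      obtain k q where "k \<in> coarse_scales d a R u" "k \<in> coarse_scales d a R v"
        "q \<in> grid d (coarse_set d a u k)" "q \<in> grid d (coarse_set d a v k)"
        "hdist d u q + hdist d q v \<le> hdist d u v + 2 * a + 4" by blast
      then show "\<exists>q\<in>S u \<inter> S v. hdist d u q + hdist d q v \<le> hdist d u v + \<epsilon> * R / 32"
        unfolding S_def using a by (intro bexI[of _ q]) auto
    qed (use coarse_steiner_system[OF d \<epsilon> eR] in \<open>simp_all add: S_def a_def\<close>)
  qed
  define t where "t = \<epsilon> * R / 64"
  have t: "t > 0" using \<epsilon> R by (simp add: t_def)
  have "\<forall>q\<in>hyp_space d. \<exists>q'. q' \<in> hyp_space d - P \<and> hdist d q q' \<le> t"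
    using exists_near_point_avoiding[OF _ d P t] by blast
  then obtain \<phi> where \<phi>: "\<And>q. q \<in> hyp_space d \<Longrightarrow> \<phi> q \<in> hyp_space d - P \<and> hdist d q (\<phi> q) \<le> t"
    by metis
  show ?thesis
  proof (intro exI[of _ "\<lambda>u. \<phi> ` S u"] conjI ballI impI)
    fix u assume u: "u \<in> hyp_space d"
    show "finite (\<phi> ` S u)" using S(1)[OF u] by simp
    show "\<phi> ` S u \<subseteq> hyp_space d - P" using S(2)[OF u] \<phi> by blast
    show "real (card (\<phi> ` S u)) \<le> (10 ^ 6 * real d) ^ (d + 1) * steiner_growth d \<epsilon>"
      using S(3)[OF u] card_image_le[OF S(1)[OF u], of \<phi>] by linarith
    fix v assume v: "v \<in> hyp_space d" and uv: "R / 16 \<le> hdist d u v" "hdist d u v \<le> 2 * R"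
    from Sq[OF u v uv] obtain q where q: "q \<in> S u" "q \<in> S v"
      "hdist d u q + hdist d q v \<le> hdist d u v + \<epsilon> * R / 32" by blast
    have qH: "q \<in> hyp_space d" using q S(2)[OF u] by blast
    have \<phi>q: "\<phi> q \<in> hyp_space d" "hdist d q (\<phi> q) \<le> t" using \<phi>[OF qH] by auto
    have "hdist d u (\<phi> q) \<le> hdist d u q + t"
      using hdist_triangle[OF u qH \<phi>q(1) d1] \<phi>q by simp
    moreover have "hdist d (\<phi> q) v \<le> hdist d q v + t"
      using hdist_triangle[OF \<phi>q(1) qH v d1] \<phi>q by (simp add: hdist_commute)
    ultimately have "hdist d u (\<phi> q) + hdist d (\<phi> q) v \<le> hdist d u v + \<epsilon> * R / 16"
      using q(3) by (simp add: t_def)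
    then show "\<exists>q\<in>\<phi> ` S u \<inter> \<phi> ` S v. hdist d u q + hdist d q v \<le> hdist d u v + \<epsilon> * R / 16"
      using q by blast
  qed
qed

section \<open>Hierarchical clustering of a finite metric space\<close>

lemma exists_maximal_independent:
  assumes V: "finite V"
  obtains I where "I \<subseteq> V" "\<And>x y. x \<in> I \<Longrightarrow> y \<in> I \<Longrightarrow> \<not> E x y"
    "\<And>v. v \<in> V - I \<Longrightarrow> E v v \<or> (\<exists>i\<in>I. E v i \<or> E i v)"
proof -
  define F where "F = {I. I \<subseteq> V \<and> (\<forall>x\<in>I. \<forall>y\<in>I. \<not> E x y)}"
  have "finite F" using V by (auto simp: F_def)
  moreover have "{} \<in> F" by (simp add: F_def)
  ultimately obtain I where I: "I \<in> F" "\<And>J. J \<in> F \<Longrightarrow> I \<subseteq> J \<Longrightarrow> I = J"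
    using finite_has_maximal[of F] by blast
  show thesis
  proof (rule that[of I])
    fix v assume v: "v \<in> V - I"
    show "E v v \<or> (\<exists>i\<in>I. E v i \<or> E i v)"
    proof (rule ccontr)
      assume "\<not> ?thesis"
      then have "insert v I \<in> F" using I(1) v by (auto simp: F_def)
      then show False using I(2)[of "insert v I"] v by auto
    qed
  qed (use I in \<open>auto simp: F_def\<close>)
qed

text \<open>The vertices outside a maximal independent set \<open>I\<close> join a neighbour in \<open>I\<close>, and an element of
  \<open>I\<close> that nobody joins follows one of its neighbours.\<close>

lemma exists_merging:
  assumes V: "finite V" and sym: "\<And>x y. E x y \<Longrightarrow> E y x" and irr: "\<And>x. \<not> E x x"
  shows "\<exists>f. (\<forall>v\<in>V. f v \<in> V \<and> (f v = v \<or> E v (f v) \<or> (\<exists>w\<in>V. E v w \<and> E w (f v)))) \<and>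
    (\<forall>v\<in>V. (\<exists>w\<in>V. E v w) \<longrightarrow> (\<exists>w\<in>V. w \<noteq> v \<and> f w = f v))"
proof -
  obtain I where I: "I \<subseteq> V" "\<And>x y. x \<in> I \<Longrightarrow> y \<in> I \<Longrightarrow> \<not> E x y"
    "\<And>v. v \<in> V - I \<Longrightarrow> \<exists>i\<in>I. E v i"
    using exists_maximal_independent[OF V, of E] sym irr by metis
  obtain c where c: "\<And>v. v \<in> V - I \<Longrightarrow> c v \<in> I \<and> E v (c v)" using I(3) by metis
  define n where "n = (\<lambda>v. SOME w. w \<in> V \<and> E v w)"
  have n: "n v \<in> V \<and> E v (n v)" if "\<exists>w\<in>V. E v w" for v
    using that someI_ex[of "\<lambda>w. w \<in> V \<and> E v w"] unfolding n_def by blast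
  have nI: "n v \<in> V - I" if "v \<in> I" "\<exists>w\<in>V. E v w" for v using n[OF that(2)] I(2) that by blast
  define f where "f = (\<lambda>v. if v \<notin> I then c v
     else if (\<exists>w\<in>V - I. c w = v) \<or> \<not> (\<exists>w\<in>V. E v w) then v else c (n v))"
  show ?thesis
  proof (intro exI[of _ f] conjI[of "Ball _ _"] ballI impI)
    fix v assume v: "v \<in> V"
    show "f v \<in> V \<and> (f v = v \<or> E v (f v) \<or> (\<exists>w\<in>V. E v w \<and> E w (f v)))"
    proof (cases "v \<in> I \<and> \<not> (\<exists>w\<in>V - I. c w = v) \<and> (\<exists>w\<in>V. E v w)")
      case True
      then have "f v = c (n v)" by (simp add: f_def)
      moreover have "n v \<in> V - I" "E v (n v)" using True nI n by auto
      ultimately show ?thesis using c[of "n v"] I(1) by auto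
    next
      case False
      then show ?thesis using v c[of v] I(1) by (auto simp: f_def)
    qed
    assume nb: "\<exists>w\<in>V. E v w"
    show "\<exists>w\<in>V. w \<noteq> v \<and> f w = f v"
    proof (cases "v \<in> I")
      case False
      then have "c v \<in> I" "f v = c v" using c[of v] v by (auto simp: f_def)
      moreover have "f (c v) = c v" using \<open>c v \<in> I\<close> False v by (auto simp: f_def)
      ultimately show ?thesis using I(1) False by (intro bexI[of _ "c v"]) auto
    next
      case vI: True
      show ?thesis
      proof (cases "\<exists>w\<in>V - I. c w = v")
        case True
        then obtain w where "w \<in> V - I" "c w = v" by blast
        then show ?thesis using vI by (intro bexI[of _ w]) (auto simp: f_def)
      next
        case False
        then have "f v = c (n v)" using vI nb by (simp add: f_def)
        then show ?thesis using nI[OF vI nb] vI by (intro bexI[of _ "n v"]) (auto simp: f_def)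
      qed
    qed
  qed
qed

section \<open>The levels of the clustering\<close>

locale finite_metric =
  fixes P :: "'a set" and \<delta> :: "'a \<Rightarrow> 'a \<Rightarrow> real"
  assumes fin: "finite P"
    and refl: "p \<in> P \<Longrightarrow> \<delta> p p = 0"
    and sym: "\<delta> p q = \<delta> q p"
    and triangle: "p \<in> P \<Longrightarrow> q \<in> P \<Longrightarrow> r \<in> P \<Longrightarrow> \<delta> p r \<le> \<delta> p q + \<delta> q r"
begin

text \<open>Labels of clusters at distance at most \<open>T\<close> are within \<open>3 * T\<close>;
  merging follows at most two such edges, and reaching the old label costs another \<open>T\<close>,
  so \<open>7 * T\<close> in all. The new label is a function of the old one, which makes the
  clusterings nested.\<close>

lemma merge_labels:
  assumes c: "\<And>p. p \<in> P \<Longrightarrow> c p \<in> P \<and> \<delta> p (c p) \<le> T" and T: "T \<ge> 0"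
  shows "\<exists>c'. (\<forall>p\<in>P. c' p \<in> P \<and> \<delta> p (c' p) \<le> 8 * T) \<and> (\<forall>p q. c p = c q \<longrightarrow> c' p = c' q) \<and>
    (\<forall>p\<in>P. \<forall>q\<in>P. \<delta> p q \<le> T \<longrightarrow> c p \<noteq> c q \<longrightarrow> (\<exists>w\<in>P. c w \<noteq> c p \<and> c' w = c' p))"
proof -
  define E where "E = (\<lambda>a b. a \<noteq> b \<and> (\<exists>p\<in>P. \<exists>q\<in>P. c p = a \<and> c q = b \<and> \<delta> p q \<le> T))"
  have E: "\<delta> a b \<le> 3 * T" "a \<in> P" "b \<in> P" if ab: "E a b" for a b
  proof -
    obtain p q where pq: "p \<in> P" "q \<in> P" "c p = a" "c q = b" "\<delta> p q \<le> T"
      using ab unfolding E_def by blast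
    then show P: "a \<in> P" "b \<in> P" using c by auto
    have "\<delta> a b \<le> \<delta> a p + \<delta> p b" "\<delta> p b \<le> \<delta> p q + \<delta> q b" using triangle pq P by auto
    then show "\<delta> a b \<le> 3 * T" using c[OF pq(1)] c[OF pq(2)] pq sym[of a p] by auto
  qed
  have 1: "finite (c ` P)" using fin by simp
  have 2: "E y x" if "E x y" for x y
  proof -
    obtain p q where "p \<in> P" "q \<in> P" "c p = x" "c q = y" "\<delta> p q \<le> T" "x \<noteq> y"
      using \<open>E x y\<close> unfolding E_def by blast
    then show ?thesis unfolding E_def using sym[of p q] by auto
  qed
  have 3: "\<not> E x x" for x by (simp add: E_def)
  obtain f where f:
    "\<forall>v\<in>c ` P. f v \<in> c ` P \<and> (f v = v \<or> E v (f v) \<or> (\<exists>w\<in>c ` P. E v w \<and> E w (f v)))"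
    "\<forall>v\<in>c ` P. (\<exists>w\<in>c ` P. E v w) \<longrightarrow> (\<exists>w\<in>c ` P. w \<noteq> v \<and> f w = f v)"
    using exists_merging[where E = E, OF 1 2 3] by blast
  have near: "f (c p) \<in> P \<and> \<delta> p (f (c p)) \<le> 8 * T" if p: "p \<in> P" for p
  proof -
    have fP: "f (c p) \<in> P" using f(1) p c by auto
    consider "f (c p) = c p" | "E (c p) (f (c p))" | w where "E (c p) w" "E w (f (c p))"
      using f(1) p by blast
    then have "\<delta> (c p) (f (c p)) \<le> 6 * T"
    proof cases
      case 1
      then show ?thesis using refl c[OF p] T by simp
    next
      case 2
      then show ?thesis using E[OF 2] T by simp
    next
      case 3
      have "\<delta> (c p) (f (c p)) \<le> \<delta> (c p) w + \<delta> w (f (c p))"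
        using triangle E(2)[OF 3(1)] E(2,3)[OF 3(2)] by blast
      then show ?thesis using E(1)[OF 3(1)] E(1)[OF 3(2)] by linarith
    qed
    then have "\<delta> p (f (c p)) \<le> 8 * T" using triangle[of p "c p" "f (c p)"] c[OF p] p fP T by auto
    then show ?thesis using fP by simp
  qed
  have merged: "\<exists>w\<in>P. c w \<noteq> c p \<and> f (c w) = f (c p)"
    if "p \<in> P" "q \<in> P" "\<delta> p q \<le> T" "c p \<noteq> c q" for p q
  proof -
    have "E (c p) (c q)" unfolding E_def using that by blast
    then have "\<exists>w\<in>c ` P. w \<noteq> c p \<and> f w = f (c p)" using f(2) that by blast
    then show ?thesis by auto
  qed
  show ?thesis
    by (rule exI[of _ "\<lambda>p. f (c p)"]) (simp add: near merged)
qed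

text \<open>Dependent choice iterates \<open>merge_labels\<close> from the identity labelling; the
  base 8 is the growth of the radius in one step.\<close>

lemma exists_clustering:
  assumes "\<tau> > 0"
  obtains c where "\<And>n p. p \<in> P \<Longrightarrow> c n p \<in> P" "\<And>n p. p \<in> P \<Longrightarrow> \<delta> p (c n p) \<le> \<tau> * 8 ^ n"
    "\<And>n m p q. c n p = c n q \<Longrightarrow> n \<le> m \<Longrightarrow> c m p = c m q"
    "\<And>n p q. p \<in> P \<Longrightarrow> q \<in> P \<Longrightarrow> \<delta> p q \<le> \<tau> * 8 ^ n \<Longrightarrow> c n p \<noteq> c n q
      \<Longrightarrow> \<exists>w\<in>P. c n w \<noteq> c n p \<and> c (Suc n) w = c (Suc n) p"
proof -
  define A where "A = (\<lambda>n (c :: 'a \<Rightarrow> 'a). \<forall>p\<in>P. c p \<in> P \<and> \<delta> p (c p) \<le> \<tau> * 8 ^ n)"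
  define B where "B = (\<lambda>n (c :: 'a \<Rightarrow> 'a) (c' :: 'a \<Rightarrow> 'a). (\<forall>p q. c p = c q \<longrightarrow> c' p = c' q) \<and>
    (\<forall>p\<in>P. \<forall>q\<in>P. \<delta> p q \<le> \<tau> * 8 ^ n \<longrightarrow> c p \<noteq> c q \<longrightarrow> (\<exists>w\<in>P. c w \<noteq> c p \<and> c' w = c' p)))"
  have "\<exists>c. \<forall>n. A n (c n) \<and> B n (c n) (c (Suc n))"
  proof (rule dependent_nat_choice)
    show "\<exists>c. A 0 c" using refl assms by (intro exI[of _ "\<lambda>p. p"]) (simp add: A_def)
    fix c n assume "A n c"
    then have "\<And>p. p \<in> P \<Longrightarrow> c p \<in> P \<and> \<delta> p (c p) \<le> \<tau> * 8 ^ n" unfolding A_def by blast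
    moreover have "\<tau> * 8 ^ n \<ge> 0" using assms by simp
    ultimately obtain c' where c': "\<forall>p\<in>P. c' p \<in> P \<and> \<delta> p (c' p) \<le> 8 * (\<tau> * 8 ^ n)" "B n c c'"
      using merge_labels[of c "\<tau> * 8 ^ n"] unfolding B_def by blast
    have "A (Suc n) c'" unfolding A_def using c'(1) by (simp add: mult_ac)
    then show "\<exists>c'. A (Suc n) c' \<and> B n c c'" using c'(2) by blast
  qed
  then obtain c where A: "\<And>n. A n (c n)" and B: "\<And>n. B n (c n) (c (Suc n))" by blast
  show thesis
  proof (rule that[of c])
    show "c n p \<in> P" "\<delta> p (c n p) \<le> \<tau> * 8 ^ n" if "p \<in> P" for n p
      using A[of n] that unfolding A_def by blast+
    show "\<exists>w\<in>P. c n w \<noteq> c n p \<and> c (Suc n) w = c (Suc n) p"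
      if "p \<in> P" "q \<in> P" "\<delta> p q \<le> \<tau> * 8 ^ n" "c n p \<noteq> c n q" for n p q
      using B[of n] that unfolding B_def by blast
    fix n m p q assume "c n p = c n q" "n \<le> m"
    from this(2,1) show "c m p = c m q"
    proof (induction m rule: dec_induct)
      case (step m)
      then show ?case using B[of m] unfolding B_def by blast
    qed simp
  qed
qed

end

text \<open>In a fixed numbering of the points, \<open>X\<close> is represented by the first point that no smaller
  member of the family contains together with the first point of \<open>X\<close>.\<close>

lemma exists_laminar_representatives:
  assumes P: "finite P" and F: "\<And>X. X \<in> F \<Longrightarrow> X \<subseteq> P \<and> X \<noteq> {}"
    and laminar: "\<And>X Y. X \<in> F \<Longrightarrow> Y \<in> F \<Longrightarrow> X \<inter> Y \<noteq> {} \<Longrightarrow> X \<subseteq> Y \<or> Y \<subseteq> X"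
  obtains \<rho> where "\<And>X. X \<in> F \<Longrightarrow> \<rho> X \<in> X" "\<And>p. card {X \<in> F. \<rho> X = p} \<le> 2"
proof -
  obtain idx :: "'a \<Rightarrow> nat" where idx: "inj_on idx P"
    using finite_imp_inj_to_nat_seg[OF P] by blast
  define mn where "mn = (\<lambda>A. SOME a. a \<in> A \<and> (\<forall>b\<in>A. idx a \<le> idx b))"
  have mn: "mn A \<in> A" "\<And>b. b \<in> A \<Longrightarrow> idx (mn A) \<le> idx b" if ne: "A \<noteq> {}" for A
  proof -
    obtain a\<^sub>0 where "a\<^sub>0 \<in> A" using ne by blast
    then obtain a where "a \<in> A \<and> (\<forall>b\<in>A. idx a \<le> idx b)"
      using ex_has_least_nat[of "\<lambda>a. a \<in> A" a\<^sub>0 idx] by blast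
    then have "mn A \<in> A \<and> (\<forall>b\<in>A. idx (mn A) \<le> idx b)" unfolding mn_def by (rule someI)
    then show "mn A \<in> A" "\<And>b. b \<in> A \<Longrightarrow> idx (mn A) \<le> idx b" by auto
  qed
  \<comment> \<open>The candidates for representing \<open>X\<close>; when there are none, the first
    point of \<open>X\<close> is taken.\<close>
  define K where "K = (\<lambda>X. {p \<in> X. p \<noteq> mn X \<and> \<not> (\<exists>Y\<in>F. Y \<subset> X \<and> p \<in> Y \<and> mn X \<in> Y)})"
  define \<rho> where "\<rho> = (\<lambda>X. if K X = {} then mn X else mn (K X))"
  have finF: "finite F" using P F by (meson Pow_iff finite_Pow_iff finite_subset subsetI)
  \<comment> \<open>The smaller members containing \<open>mn X\<close> form a chain by laminarity. A
    point of \<open>X\<close> outside the largest of them is a candidate, so only singletons lack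
    one.\<close>
  have K0: "X = {mn X}" if X: "X \<in> F" and K: "K X = {}" for X
  proof (rule ccontr)
    assume ne: "X \<noteq> {mn X}"
    have mX: "mn X \<in> X" using mn(1)[of X] F[OF X] by blast
    define G where "G = {Y \<in> F. Y \<subset> X \<and> mn X \<in> Y}"
    show False
    proof (cases "G = {}")
      case True
      obtain p where p: "p \<in> X" "p \<noteq> mn X" using ne mX by blast
      have "p \<in> K X" using p True unfolding K_def G_def by blast
      then show False using K by simp
    next
      case False
      have "finite G" using finF by (simp add: G_def)
      then obtain Y where Y: "Y \<in> G" "\<And>Z. Z \<in> G \<Longrightarrow> Y \<subseteq> Z \<Longrightarrow> Y = Z"
        using finite_has_maximal[of G] False by blast
      then obtain p where p: "p \<in> X" "p \<notin> Y" unfolding G_def by blast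
      have "p \<noteq> mn X" using p Y unfolding G_def by blast
      then obtain Z where Z: "Z \<in> G" "p \<in> Z" using K p unfolding K_def G_def by blast
      then have "Z \<subseteq> Y \<or> Y \<subseteq> Z" using Y(1) laminar[of Z Y] unfolding G_def by blast
      then show False using Y(2)[OF Z(1)] Z p by blast
    qed
  qed
  \<comment> \<open>A shared \<open>p\<close> excludes \<open>mn X\<close> from \<open>X'\<close>,
    since \<open>p\<close> is a candidate of \<open>X\<close>. Then \<open>mn X'\<close> is a
    candidate of \<open>X\<close> numbered no later than \<open>p\<close>, so it equals
    \<open>p\<close>, which is impossible for a candidate of \<open>X'\<close>.\<close>
  have inj: "\<not> X' \<subset> X"
    if X: "X \<in> F" "K X \<noteq> {}" and X': "X' \<in> F" "K X' \<noteq> {}" and eq: "\<rho> X = \<rho> X'" for X X'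
  proof
    assume sub: "X' \<subset> X"
    define p where "p = \<rho> X"
    have p: "p \<in> K X" "p \<in> K X'" "\<And>b. b \<in> K X \<Longrightarrow> idx p \<le> idx b"
      using mn[OF X(2)] mn[OF X'(2)] X X' eq by (auto simp: p_def \<rho>_def)
    have pX': "p \<in> X'" "p \<noteq> mn X'" using p(2) by (auto simp: K_def)
    have mX': "mn X' \<in> X'" "idx (mn X') \<le> idx p" using mn[of X'] pX' by auto
    have mX: "mn X \<notin> X'" using p(1) pX' sub X'(1) unfolding K_def by blast
    have "mn X' \<in> K X"
    proof -
      have no: False if Y: "Y \<in> F" "Y \<subset> X" "mn X' \<in> Y" "mn X \<in> Y" for Y
      proof -
        have "Y \<subseteq> X' \<or> X' \<subseteq> Y" using laminar[OF Y(1) X'(1)] Y mX' by blast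
        then show False using mX Y pX' p(1) unfolding K_def by blast
      qed
      have "mn X' \<in> X" using mX'(1) sub by blast
      moreover have "mn X' \<noteq> mn X" using mX'(1) mX by metis
      ultimately show ?thesis using no unfolding K_def by blast
    qed
    then have "idx p \<le> idx (mn X')" by (rule p(3))
    then have "idx p = idx (mn X')" using mX' by simp
    then have "p = mn X'" using idx F[OF X'(1)] pX' mX' unfolding inj_on_def by blast
    then show False using pX' by simp
  qed
  have \<rho>in: "\<rho> X \<in> X" if "X \<in> F" for X
  proof (cases "K X = {}")
    case True
    then show ?thesis using mn[of X] F[OF that] by (simp add: \<rho>_def)
  next
    case False
    then have "\<rho> X = mn (K X)" by (simp add: \<rho>_def)
    moreover have "mn (K X) \<in> K X" using mn(1)[OF False] .
    moreover have "K X \<subseteq> X" unfolding K_def by blast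
    ultimately show ?thesis by auto
  qed
  show thesis
  proof (rule that[of \<rho>])
    fix p
    define A where "A = {X \<in> F. \<rho> X = p \<and> K X \<noteq> {}}"
    have AF: "X \<in> F" "\<rho> X = p" "K X \<noteq> {}" if "X \<in> A" for X using that unfolding A_def by simp_all
    have "X = Y" if X: "X \<in> A" and Y: "Y \<in> A" for X Y
    proof -
      have "p \<in> X" "p \<in> Y" using \<rho>in[of X] \<rho>in[of Y] AF[OF X] AF[OF Y] by simp_all
      then have "X \<subseteq> Y \<or> Y \<subseteq> X" using laminar[of X Y] AF(1)[OF X] AF(1)[OF Y] by blast
      moreover have "\<not> X \<subset> Y" using inj[of Y X] AF[OF X] AF[OF Y] by simp
      moreover have "\<not> Y \<subset> X" using inj[of X Y] AF[OF X] AF[OF Y] by simp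
      ultimately show ?thesis by blast
    qed
    moreover have finA: "finite A" using finF by (simp add: A_def)
    ultimately have "card A \<le> 1" by (simp add: card_le_Suc0_iff_eq)
    \<comment> \<open>Besides the at most one set with candidates, only the singleton of
      \<open>p\<close> can have the representative \<open>p\<close>; this is the bound 2.\<close>
    moreover have "{X \<in> F. \<rho> X = p} \<subseteq> insert {p} A"
    proof
      fix X assume X: "X \<in> {X \<in> F. \<rho> X = p}"
      show "X \<in> insert {p} A"
      proof (cases "K X = {}")
        case True
        then have "mn X = p" using X by (simp add: \<rho>_def)
        then show ?thesis using K0[of X] X True by simp
      next
        case False
        then show ?thesis using X by (simp add: A_def)
      qed
    qed
    then have "card {X \<in> F. \<rho> X = p} \<le> card (insert {p} A)"
      using finA by (intro card_mono) simp_all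
    moreover have "card (insert {p} A) \<le> Suc (card A)" using finA by (simp add: card_insert_if)
    ultimately show "card {X \<in> F. \<rho> X = p} \<le> 2" by simp
  qed (rule \<rho>in)
qed

section \<open>Walks\<close>

lemma walk_len_Cons: "walk_len \<delta> (x # y # zs) = \<delta> x y + walk_len \<delta> (y # zs)"
  unfolding walk_len_def by (simp add: sum.lessThan_Suc_shift del: sum.lessThan_Suc)

lemma is_walk_Cons:
  "is_walk E u v (x # y # zs) \<longleftrightarrow> x = u \<and> adj E x y \<and> is_walk E y v (y # zs)"
  unfolding is_walk_def by (auto simp: All_less_Suc2)

text \<open>Bounded walks can be concatenated directly, and they certify existence, which the
  infimum in \<open>graph_dist\<close> does not.\<close>

definition connected_within :: "('a \<Rightarrow> 'a \<Rightarrow> real) \<Rightarrow> ('a \<times> 'a) set \<Rightarrow> 'a \<Rightarrow> 'a \<Rightarrow> real \<Rightarrow> bool" where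
  "connected_within \<delta> E u v l \<longleftrightarrow> (\<exists>ws. is_walk E u v ws \<and> walk_len \<delta> ws \<le> l)"

lemma connected_within_refl: "connected_within \<delta> E u u 0"
  unfolding connected_within_def is_walk_def walk_len_def by (intro exI[of _ "[u]"]) simp

lemma connected_within_step:
  assumes "adj E u x" "connected_within \<delta> E x v l"
  shows "connected_within \<delta> E u v (\<delta> u x + l)"
proof -
  obtain ws where ws: "is_walk E x v ws" "walk_len \<delta> ws \<le> l"
    using assms(2) unfolding connected_within_def by blast
  then obtain zs where "ws = x # zs" unfolding is_walk_def by (cases ws) auto
  then show ?thesis
    using ws assms(1) unfolding connected_within_def
    by (intro exI[of _ "u # ws"]) (simp add: is_walk_Cons walk_len_Cons)
qed

lemma connected_within_trans:
  assumes "connected_within \<delta> E u v l" "connected_within \<delta> E v w l'"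
  shows "connected_within \<delta> E u w (l + l')"
proof -
  obtain ws where ws: "is_walk E u v ws" "walk_len \<delta> ws \<le> l"
    using assms(1) unfolding connected_within_def by blast
  have "connected_within \<delta> E u w (walk_len \<delta> ws + l')"
    using ws(1)
  proof (induction ws arbitrary: u)
    case Nil
    then show ?case by (simp add: is_walk_def)
  next
    case (Cons x ws)
    show ?case
    proof (cases ws)
      case Nil
      then have "u = v" using Cons.prems by (auto simp: is_walk_def)
      then show ?thesis using assms(2) Nil by (simp add: walk_len_def)
    next
      case (Cons y zs)
      then have "x = u" "adj E u y" "is_walk E y v ws"
        using Cons.prems by (auto simp: is_walk_Cons)
      then show ?thesis
        using connected_within_step[OF _ Cons.IH] \<open>ws = y # zs\<close> by (simp add: walk_len_Cons add.assoc)
    qed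
  qed
  then obtain ws' where "is_walk E u w ws'" "walk_len \<delta> ws' \<le> walk_len \<delta> ws + l'"
    unfolding connected_within_def by blast
  then show ?thesis unfolding connected_within_def using ws(2) by (intro exI[of _ ws']) auto
qed

lemma connected_within_mono: "connected_within \<delta> E u v l \<Longrightarrow> l \<le> l' \<Longrightarrow> connected_within \<delta> E u v l'"
  unfolding connected_within_def by (meson order_trans)

section \<open>Assembling the spanner\<close>

context finite_metric
begin

text \<open>Geometry enters only through the assumption on \<open>S\<close>. The number
  \<open>k\<close> is the gap between the level of a pair and the level of the clusters used for
  it.\<close>

theorem exists_bounded_degree_spanner:
  assumes sub: "P \<subseteq> H" and pos: "\<And>p q. p \<in> P \<Longrightarrow> q \<in> P \<Longrightarrow> p \<noteq> q \<Longrightarrow> \<delta> p q > 0"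
    and \<epsilon>: "0 < \<epsilon>" "\<epsilon> \<le> 1 / 2" and k: "160 / \<epsilon> \<le> 8 ^ k"
    and S: "\<And>R. R > 0 \<Longrightarrow> \<exists>S. (\<forall>u\<in>H. finite (S u) \<and> S u \<subseteq> H - P \<and> real (card (S u)) \<le> N) \<and>
      (\<forall>u\<in>H. \<forall>v\<in>H. R / 16 \<le> \<delta> u v \<longrightarrow> \<delta> u v \<le> 2 * R \<longrightarrow>
        (\<exists>q\<in>S u \<inter> S v. \<delta> u q + \<delta> q v \<le> \<delta> u v + \<epsilon> * R / 16))"
    and N: "N \<ge> 0"
  shows "\<exists>Q E. finite Q \<and> Q \<subseteq> H - P \<and> E \<subseteq> P \<times> Q \<and>
    (\<forall>u\<in>P. \<forall>v\<in>P. connected_within \<delta> E u v ((1 + \<epsilon>) * \<delta> u v)) \<and>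
    (\<forall>p\<in>P. real (degree E p) \<le> 2 * (real k + 1) * N)"
proof -
  \<comment> \<open>Inserting 1 keeps the set nonempty when \<open>P\<close> has at most one
    point.\<close>
  define D where "D = insert 1 ((\<lambda>(p, q). \<delta> p q) ` {(p, q). p \<in> P \<and> q \<in> P \<and> p \<noteq> q})"
  have finD: "finite D"
  proof -
    have "{(p, q). p \<in> P \<and> q \<in> P \<and> p \<noteq> q} \<subseteq> P \<times> P" by auto
    then have "finite {(p, q). p \<in> P \<and> q \<in> P \<and> p \<noteq> q}"
      by (rule finite_subset) (simp add: fin)
    then show ?thesis by (simp add: D_def)
  qed
  have D0: "0 < x" if "x \<in> D" for x using that pos by (auto simp: D_def)
  \<comment> \<open>So small that the level \<open>m\<close> of every pair exceeds \<open>k\<close>,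
    which makes \<open>m - k\<close> a genuine level.\<close>
  define \<tau> where "\<tau> = Min D / (2 * 8 ^ k)"
  have "Min D \<in> D" using finD by (intro Min_in) (auto simp: D_def)
  then have MinD: "Min D > 0" by (rule D0)
  then have \<tau>: "\<tau> > 0" by (simp add: \<tau>_def)
  have \<tau>D: "\<tau> * 8 ^ k < \<delta> u v" if "u \<in> P" "v \<in> P" "u \<noteq> v" for u v
  proof -
    have "\<delta> u v \<in> D" using that by (auto simp: D_def)
    then have "Min D \<le> \<delta> u v" using finD by simp
    moreover have "\<tau> * 8 ^ k = Min D / 2" by (simp add: \<tau>_def)
    ultimately show ?thesis using MinD by linarith
  qed
  define T where "T = (\<lambda>n. \<tau> * 8 ^ n)"
  have T0: "T n > 0" for n using \<tau> by (simp add: T_def)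
  obtain c where c: "\<And>n p. p \<in> P \<Longrightarrow> c n p \<in> P" "\<And>n p. p \<in> P \<Longrightarrow> \<delta> p (c n p) \<le> T n"
    and mono: "\<And>n m p q. c n p = c n q \<Longrightarrow> n \<le> m \<Longrightarrow> c m p = c m q"
    and merge: "\<And>n p q. p \<in> P \<Longrightarrow> q \<in> P \<Longrightarrow> \<delta> p q \<le> T n \<Longrightarrow> c n p \<noteq> c n q
      \<Longrightarrow> \<exists>w\<in>P. c n w \<noteq> c n p \<and> c (Suc n) w = c (Suc n) p"
    unfolding T_def by (fact exists_clustering[OF \<tau>])
  define C where "C = (\<lambda>n p. {x \<in> P. c n x = c n p})"
  have Cself: "p \<in> C n p" if "p \<in> P" for n p using that by (simp add: C_def)
  have CP: "C n p \<subseteq> P" for n p by (auto simp: C_def)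
  have Ceq: "C n p = C n q" if "p \<in> C n q" for n p q using that by (auto simp: C_def)
  have Cmono: "C n p \<subseteq> C m p" if "n \<le> m" for n m p
  proof
    fix x assume "x \<in> C n p"
    then have "x \<in> P" "c n x = c n p" by (simp_all add: C_def)
    then show "x \<in> C m p" using mono[OF _ that, of x p] by (simp add: C_def)
  qed
  have diam: "\<delta> a b \<le> 2 * T n" if "a \<in> C n p" "b \<in> C n p" for a b n p
  proof -
    have ab: "a \<in> P" "b \<in> P" "c n a = c n b" using that by (auto simp: C_def)
    have "\<delta> a b \<le> \<delta> a (c n a) + \<delta> (c n a) b" using triangle ab c(1) by blast
    then show ?thesis using c(2)[OF ab(1), of n] c(2)[OF ab(2), of n] ab(3) sym[of b "c n b"] by simp
  qed
  \<comment> \<open>Clusters are collected as sets, so one that persists over several levels has a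
    single representative.\<close>
  define F where "F = {C n p | n p. p \<in> P}"
  have FP: "X \<subseteq> P \<and> X \<noteq> {}" if "X \<in> F" for X using that Cself CP unfolding F_def by blast
  have finF: "finite F" by (rule finite_subset[of _ "Pow P"]) (use FP fin in auto)
  obtain \<rho> where \<rho>: "\<And>X. X \<in> F \<Longrightarrow> \<rho> X \<in> X" "\<And>p. card {X \<in> F. \<rho> X = p} \<le> 2"
  proof (rule exists_laminar_representatives[of P F])
    show "finite P" by (rule fin)
    show "X \<subseteq> P \<and> X \<noteq> {}" if "X \<in> F" for X by (rule FP[OF that])
    show "X \<subseteq> Y \<or> Y \<subseteq> X" if XY: "X \<in> F" "Y \<in> F" "X \<inter> Y \<noteq> {}" for X Y
    proof -
      obtain n p m q where "X = C n p" "Y = C m q" using XY unfolding F_def by blast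
      moreover obtain r where "r \<in> X" "r \<in> Y" using XY by blast
      ultimately have "X = C n r" "Y = C m r" using Ceq by auto
      then show ?thesis using Cmono[of n m r] Cmono[of m n r] by (cases "n \<le> m") auto
    qed
  qed (rule that)
  have "\<forall>n. \<exists>S. (\<forall>u\<in>H. finite (S u) \<and> S u \<subseteq> H - P \<and> real (card (S u)) \<le> N) \<and>
      (\<forall>u\<in>H. \<forall>v\<in>H. T n / 16 \<le> \<delta> u v \<longrightarrow> \<delta> u v \<le> 2 * T n \<longrightarrow>
        (\<exists>q\<in>S u \<inter> S v. \<delta> u q + \<delta> q v \<le> \<delta> u v + \<epsilon> * T n / 16))"
    using S T0 by blast
  then obtain s where "\<forall>n. (\<forall>u\<in>H. finite (s n u) \<and> s n u \<subseteq> H - P \<and> real (card (s n u)) \<le> N) \<and>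
      (\<forall>u\<in>H. \<forall>v\<in>H. T n / 16 \<le> \<delta> u v \<longrightarrow> \<delta> u v \<le> 2 * T n \<longrightarrow>
        (\<exists>q\<in>s n u \<inter> s n v. \<delta> u q + \<delta> q v \<le> \<delta> u v + \<epsilon> * T n / 16))"
    by (rule choice[THEN exE])
  then have s: "\<And>n u. u \<in> H \<Longrightarrow> finite (s n u) \<and> s n u \<subseteq> H - P \<and> real (card (s n u)) \<le> N"
    and sq: "\<And>n u v. u \<in> H \<Longrightarrow> v \<in> H \<Longrightarrow> T n / 16 \<le> \<delta> u v \<Longrightarrow> \<delta> u v \<le> 2 * T n \<Longrightarrow>
        \<exists>q\<in>s n u \<inter> s n v. \<delta> u q + \<delta> q v \<le> \<delta> u v + \<epsilon> * T n / 16"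
    by simp_all
  \<comment> \<open>The levels at which \<open>X\<close> may be asked to serve some pair with
    exactly one end in it.\<close>
  define J where "J = (\<lambda>X. {j. (\<exists>p\<in>P. X = C j p) \<and> (\<exists>u\<in>X. \<exists>v\<in>P - X. \<delta> u v \<le> T (j + k))})"
  \<comment> \<open>If \<open>X\<close> were still a cluster beyond level \<open>j + k\<close>, it
    would be one at level \<open>j + k\<close> with a foreign point within \<open>T (j + k)\<close>;
    merging would then enlarge it at the next level.\<close>
  have Jgap: "j' \<le> j + k" if j: "j \<in> J X" and j': "j' \<in> J X" for j j' X
  proof (rule ccontr)
    assume "\<not> j' \<le> j + k"
    then have lt: "Suc (j + k) \<le> j'" by simp
    obtain u v where uv: "u \<in> X" "v \<in> P - X" "\<delta> u v \<le> T (j + k)" using j unfolding J_def by blast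
    obtain p p' where pp: "X = C j p" "X = C j' p'" using j j' unfolding J_def by blast
    have X: "X = C j u" "X = C j' u"
      using Ceq[of u j p] Ceq[of u j' p'] uv(1) pp by simp_all
    have uP: "u \<in> P" using uv(1) X CP by blast
    have X2: "C (j + k) u \<subseteq> X" "X \<subseteq> C (j + k) u"
      using Cmono[of "j + k" j' u] Cmono[of j "j + k" u] lt X by auto
    have "c (j + k) u \<noteq> c (j + k) v" using X2(1) uv(2) unfolding C_def by force
    then obtain w where w: "w \<in> P" "c (j + k) w \<noteq> c (j + k) u" "c (Suc (j + k)) w = c (Suc (j + k)) u"
      using merge[OF uP _ uv(3)] uv(2) by blast
    have "w \<in> C (Suc (j + k)) u" using w by (simp add: C_def)
    then have "w \<in> X" using Cmono[OF lt, of u] X(2) by blast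
    then have "w \<in> C (j + k) u" using X2 by blast
    then show False using w(2) by (simp add: C_def)
  qed
  have cardJ: "finite (J X)" "card (J X) \<le> k + 1" for X
  proof -
    have "\<exists>m. J X \<subseteq> {m..m + k}"
    proof (cases "J X = {}")
      case False
      define m where "m = (LEAST j. j \<in> J X)"
      have "\<exists>j. j \<in> J X" using False by blast
      then have mJ: "m \<in> J X" unfolding m_def by (rule LeastI_ex)
      have "j \<in> {m..m + k}" if j: "j \<in> J X" for j
      proof -
        have "m \<le> j" unfolding m_def using j by (rule Least_le)
        then show ?thesis using Jgap[OF mJ j] by simp
      qed
      then show ?thesis by blast
    qed simp
    then obtain m where m: "J X \<subseteq> {m..m + k}" by blast
    then show "finite (J X)" by (rule finite_subset) simp
    show "card (J X) \<le> k + 1" using card_mono[OF _ m] by simp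
  qed
  define E where "E = (\<Union>X\<in>F. \<Union>j\<in>J X. {\<rho> X} \<times> s (j + k) (\<rho> X))"
  define Q where "Q = snd ` E"
  have \<rho>P: "\<rho> X \<in> P" if "X \<in> F" for X using \<rho>(1)[OF that] FP[OF that] by blast
  then have \<rho>H: "\<rho> X \<in> H" if "X \<in> F" for X using that sub by blast
  have finE: "finite E"
    unfolding E_def using finF cardJ(1) s[OF \<rho>H] by (intro finite_UN_I finite_cartesian_product) auto
  have EH: "E \<subseteq> P \<times> (H - P)"
    unfolding E_def using \<rho>P s[OF \<rho>H] by blast
  have finQ: "finite Q" using finE by (simp add: Q_def)
  have QH: "Q \<subseteq> H - P" using EH unfolding Q_def by auto
  have EQ: "E \<subseteq> P \<times> Q" using EH unfolding Q_def by force
  have deg: "real (degree E p) \<le> 2 * (real k + 1) * N" if p: "p \<in> P" for p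
  proof -
    define Fp where "Fp = {X \<in> F. \<rho> X = p}"
    have finFp: "finite Fp" using finF by (simp add: Fp_def)
    have pH: "p \<in> H" using p sub by blast
    have "{q. adj E p q} \<subseteq> (\<Union>X\<in>Fp. \<Union>j\<in>J X. s (j + k) p)"
    proof
      fix q assume "q \<in> {q. adj E p q}"
      moreover have "(q, p) \<notin> E" using EH p by blast
      ultimately have "(p, q) \<in> E" by (simp add: adj_def)
      then show "q \<in> (\<Union>X\<in>Fp. \<Union>j\<in>J X. s (j + k) p)" unfolding E_def Fp_def by auto
    qed
    moreover have "finite (\<Union>X\<in>Fp. \<Union>j\<in>J X. s (j + k) p)"
      using finFp cardJ(1) s[OF pH] by auto
    ultimately have "degree E p \<le> card (\<Union>X\<in>Fp. \<Union>j\<in>J X. s (j + k) p)"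
      unfolding degree_def by (intro card_mono)
    then have "real (degree E p) \<le> real (card (\<Union>X\<in>Fp. \<Union>j\<in>J X. s (j + k) p))" by simp
    also have "\<dots> \<le> 2 * ((real k + 1) * N)"
    proof (rule card_UN_le_mult[OF finFp])
      show "real (card Fp) \<le> 2" using \<rho>(2)[of p] by (simp add: Fp_def)
      fix X assume "X \<in> Fp"
      show "finite (\<Union>j\<in>J X. s (j + k) p)" using cardJ(1) s[OF pH] by auto
      show "real (card (\<Union>j\<in>J X. s (j + k) p)) \<le> (real k + 1) * N"
      proof (rule card_UN_le_mult[OF cardJ(1)])
        show "real (card (J X)) \<le> real k + 1" using cardJ(2)[of X] by linarith
      qed (use s[OF pH] N in auto)
    qed (use N in simp)
    finally show ?thesis by (simp only: mult.assoc)
  qed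
  have span: "connected_within \<delta> E u v ((1 + \<epsilon>) * \<delta> u v)" if "u \<in> P" "v \<in> P" for u v
    using that
  \<comment> \<open>Counting the closer pairs gives a well-founded measure for induction on the
    real-valued distance.\<close>
  proof (induction "card {(a, b). a \<in> P \<and> b \<in> P \<and> \<delta> a b < \<delta> u v}" arbitrary: u v rule: less_induct)
    case less
    note uv = \<open>u \<in> P\<close> \<open>v \<in> P\<close>
    show ?case
    proof (cases "u = v")
      case True
      then show ?thesis using connected_within_refl[of \<delta> E u] refl[OF uv(1)] by simp
    next
      case False
      have IH: "connected_within \<delta> E a b ((1 + \<epsilon>) * \<delta> a b)"
        if ab: "a \<in> P" "b \<in> P" "\<delta> a b < \<delta> u v" for a b
      proof (rule less.hyps)
        have "{(x, y). x \<in> P \<and> y \<in> P \<and> \<delta> x y < \<delta> a b} \<subset> {(x, y). x \<in> P \<and> y \<in> P \<and> \<delta> x y < \<delta> u v}"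
          using ab by auto
        moreover have "finite {(x, y). x \<in> P \<and> y \<in> P \<and> \<delta> x y < \<delta> u v}"
          by (rule finite_subset[of _ "P \<times> P"]) (use fin in auto)
        ultimately show "card {(x, y). x \<in> P \<and> y \<in> P \<and> \<delta> x y < \<delta> a b}
            < card {(x, y). x \<in> P \<and> y \<in> P \<and> \<delta> x y < \<delta> u v}"
          by (intro psubset_card_mono)
      qed (use ab in auto)
      have "\<exists>m. \<delta> u v \<le> T m"
      proof -
        obtain m where "\<delta> u v / \<tau> < 8 ^ m" using real_arch_pow[of 8] by auto
        then show ?thesis using \<tau> by (intro exI[of _ m]) (simp add: T_def field_simps)
      qed
      \<comment> \<open>Minimality places the distance between \<open>T m / 8\<close> and
        \<open>T m\<close>.\<close>
      define m where "m = (LEAST m. \<delta> u v \<le> T m)"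
      have m: "\<delta> u v \<le> T m" unfolding m_def using \<open>\<exists>m. \<delta> u v \<le> T m\<close> by (rule LeastI_ex)
      have mk: "k < m"
      proof (rule ccontr)
        assume "\<not> k < m"
        then have "T m \<le> T k" using \<tau> by (auto simp: T_def intro!: power_increasing)
        then show False using m \<tau>D[OF uv False] by (simp add: T_def)
      qed
      have m1: "T m / 8 < \<delta> u v"
      proof -
        obtain m' where m': "m = Suc m'" using mk by (cases m) auto
        then have "\<not> \<delta> u v \<le> T m'" using not_less_Least[of m' "\<lambda>m. \<delta> u v \<le> T m"] by (simp add: m_def)
        then show ?thesis by (simp add: T_def m')
      qed
      define j where "j = m - k"
      have mj: "m = j + k" using mk by (simp add: j_def)
      have Tj: "T j \<le> \<epsilon> * T m / 160"
      proof -
        have "T j * (160 / \<epsilon>) \<le> T j * 8 ^ k" using k T0[of j] by (intro mult_left_mono) auto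
        also have "\<dots> = T m" by (simp add: T_def mj power_add)
        finally show ?thesis using \<epsilon> by (simp add: field_simps)
      qed
      have "\<epsilon> * T m \<le> 1 / 2 * T m" using \<epsilon> T0[of m] by (intro mult_right_mono) auto
      then have Tj2: "T j \<le> T m / 320" using Tj by linarith
      define X where "X = C j u"
      define Y where "Y = C j v"
      have XF: "X \<in> F" "Y \<in> F" using uv unfolding X_def Y_def F_def by auto
      have uX: "u \<in> X" "v \<in> Y" using Cself uv by (auto simp: X_def Y_def)
      \<comment> \<open>Clusters of level \<open>j\<close> have diameter at most
        \<open>T m / 160\<close>, too small to contain both ends.\<close>
      have vX: "v \<notin> X"
        using diam[of u j u v] uX m1 Tj2 T0[of m] unfolding X_def by auto
      have uY: "u \<notin> Y"
        using diam[of u j v v] uX m1 Tj2 T0[of m] unfolding Y_def by auto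
      have jX: "j \<in> J X" unfolding J_def using uv uX vX m mj by (auto simp: X_def)
      have "\<exists>a\<in>Y. \<exists>b\<in>P - Y. \<delta> a b \<le> T (j + k)"
        using uX uY uv m mj sym[of u v] by (intro bexI[of _ v] bexI[of _ u]) auto
      then have jY: "j \<in> J Y" unfolding J_def using uv by (auto simp: Y_def)
      define u' where "u' = \<rho> X"
      define v' where "v' = \<rho> Y"
      have u': "u' \<in> X" "u' \<in> P" "v' \<in> Y" "v' \<in> P"
        using \<rho>(1)[OF XF(1)] \<rho>(1)[OF XF(2)] \<rho>P[OF XF(1)] \<rho>P[OF XF(2)] by (auto simp: u'_def v'_def)
      have du: "\<delta> u u' \<le> 2 * T j" "\<delta> u' u \<le> 2 * T j" "\<delta> v' v \<le> 2 * T j" "\<delta> v v' \<le> 2 * T j"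
        using diam uX u' unfolding X_def Y_def by blast+
      have d1: "\<delta> u' v' \<le> \<delta> u v + 4 * T j"
        using triangle[OF u'(2) uv(1) u'(4)] triangle[OF uv u'(4)] du by linarith
      have d2: "\<delta> u v \<le> \<delta> u' v' + 4 * T j"
        using triangle[OF uv(1) u'(2) uv(2)] triangle[OF u'(2,4) uv(2)] du by linarith
      have "\<exists>q\<in>s m u' \<inter> s m v'. \<delta> u' q + \<delta> q v' \<le> \<delta> u' v' + \<epsilon> * T m / 16"
      proof (rule sq)
        show "u' \<in> H" "v' \<in> H" using u' sub by auto
        show "T m / 16 \<le> \<delta> u' v'" using d2 m1 Tj2 T0[of m] by linarith
        show "\<delta> u' v' \<le> 2 * T m" using d1 m Tj2 T0[of m] by linarith
      qed
      then obtain q where q: "q \<in> s m u'" "q \<in> s m v'"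
        "\<delta> u' q + \<delta> q v' \<le> \<delta> u' v' + \<epsilon> * T m / 16" by blast
      have "(u', q) \<in> E" "(v', q) \<in> E"
        unfolding E_def using q jX jY XF mj by (auto simp: u'_def v'_def)
      then have "connected_within \<delta> E u' v' (\<delta> u' q + (\<delta> q v' + 0))"
        by (intro connected_within_step connected_within_refl) (auto simp: adj_def)
      then have c2: "connected_within \<delta> E u' v' (\<delta> u' v' + \<epsilon> * T m / 16)"
        by (rule connected_within_mono) (use q(3) in simp)
      have small: "2 * T j < \<delta> u v" using m1 Tj2 T0[of m] by linarith
      have c1: "connected_within \<delta> E u u' ((1 + \<epsilon>) * \<delta> u u')"
        using IH[OF uv(1) u'(2)] du(1) small by linarith
      have c3: "connected_within \<delta> E v' v ((1 + \<epsilon>) * \<delta> v' v)"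
        using IH[OF u'(4) uv(2)] du(3) small by linarith
      have "connected_within \<delta> E u v
          ((1 + \<epsilon>) * \<delta> u u' + (\<delta> u' v' + \<epsilon> * T m / 16) + (1 + \<epsilon>) * \<delta> v' v)"
        by (rule connected_within_trans[OF connected_within_trans[OF c1 c2] c3])
      then show ?thesis
      proof (rule connected_within_mono)
        \<comment> \<open>The error budget: moving to the representatives costs
          \<open>4 * T j\<close> and the two recursive walks at most \<open>3 * T j\<close> each.
          The total \<open>10 * T j\<close> is at most \<open>\<epsilon> * T m / 16\<close>, which
          explains the 160; the Steiner detour uses as much again.\<close>
        have "(1 + \<epsilon>) * \<delta> u u' \<le> (1 + \<epsilon>) * (2 * T j)" "(1 + \<epsilon>) * \<delta> v' v \<le> (1 + \<epsilon>) * (2 * T j)"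
          using du \<epsilon> by (auto intro: mult_left_mono)
        moreover have "(1 + \<epsilon>) * (2 * T j) \<le> 3 / 2 * (2 * T j)"
          using \<epsilon> T0[of j] by (intro mult_right_mono) auto
        ultimately have "(1 + \<epsilon>) * \<delta> u u' + (\<delta> u' v' + \<epsilon> * T m / 16) + (1 + \<epsilon>) * \<delta> v' v
            \<le> \<delta> u v + 10 * T j + \<epsilon> * T m / 16" using d1 by linarith
        also have "\<dots> \<le> \<delta> u v + \<epsilon> * (T m / 8)" using Tj by simp
        also have "\<epsilon> * (T m / 8) \<le> \<epsilon> * \<delta> u v" using m1 \<epsilon> by (intro mult_left_mono) auto
        finally show "(1 + \<epsilon>) * \<delta> u u' + (\<delta> u' v' + \<epsilon> * T m / 16) + (1 + \<epsilon>) * \<delta> v' v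
            \<le> (1 + \<epsilon>) * \<delta> u v" by (simp add: algebra_simps)
      qed
    qed
  qed
  show ?thesis
    by (rule exI[of _ Q], rule exI[of _ E]) (intro conjI ballI finQ QH EQ span deg)
qed

end

section \<open>Constants and conclusion\<close>

lemma exists_level_count:
  assumes "0 < \<epsilon>" "\<epsilon> \<le> 1 / 2"
  obtains k :: nat where "160 / \<epsilon> \<le> 8 ^ k" "real k + 1 \<le> 12 * ln (1 / \<epsilon>)"
proof -
  define x where "x = log 8 (160 / \<epsilon>)"
  define k where "k = nat \<lceil>x\<rceil>"
  have l2: "2 / 3 \<le> ln (2::real)" by (rule ln2_ge_two_thirds)
  have le: "ln 2 \<le> ln (1 / \<epsilon>)" using assms by (subst ln_le_cancel_iff) (auto simp: field_simps)
  have "ln (8::real) = ln (2 ^ 3)" by simp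
  also have "\<dots> = 3 * ln 2" by (subst ln_realpow) auto
  finally have l8: "ln 8 = 3 * ln (2::real)" .
  have "ln (160::real) \<le> ln (2 ^ 8)" by (subst ln_le_cancel_iff) auto
  also have "\<dots> = 8 * ln 2" by (subst ln_realpow) auto
  finally have l160: "ln 160 \<le> 8 * ln (2::real)" .
  have "1 \<le> 160 / \<epsilon>" using assms by (simp add: field_simps)
  then have x0: "x \<ge> 0" unfolding x_def using zero_le_log_cancel_iff[of 8 "160 / \<epsilon>"] by linarith
  have kx: "x \<le> k" "k \<le> x + 1" using x0 unfolding k_def by linarith+
  have "160 / \<epsilon> = 8 powr x" unfolding x_def using assms by simp
  also have "\<dots> \<le> 8 powr k" using kx by simp
  also have "\<dots> = 8 ^ k" by (simp add: powr_realpow)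
  finally have k1: "160 / \<epsilon> \<le> 8 ^ k" .
  have "x = (ln 160 + ln (1 / \<epsilon>)) / ln 8"
    unfolding x_def log_def using assms by (simp add: ln_div)
  also have "\<dots> \<le> (9 * ln (1 / \<epsilon>)) / ln 8" using l160 le l8 l2 by (intro divide_right_mono) auto
  also have "\<dots> \<le> (9 * ln (1 / \<epsilon>)) / 1" using l8 l2 le by (intro divide_left_mono) auto
  finally have "x \<le> 9 * ln (1 / \<epsilon>)" by simp
  \<comment> \<open>Since \<open>ln (1 / \<epsilon>) \<ge> ln 2 \<ge> 2 / 3\<close>, the additive 2
    in \<open>k + 1 \<le> x + 2\<close> costs only three more logarithms.\<close>
  then have "real k + 1 \<le> 12 * ln (1 / \<epsilon>)" using kx le l2 by linarith
  then show thesis using k1 that by blast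
qed

text \<open>The infimum is usable only if walk lengths are bounded below; they are nonnegative
  because edges stay inside \<open>H\<close>.\<close>

lemma graph_dist_le:
  assumes E: "E \<subseteq> H \<times> H" and u: "u \<in> H" and nonneg: "\<And>x y. x \<in> H \<Longrightarrow> y \<in> H \<Longrightarrow> \<delta> x y \<ge> 0"
    and c: "connected_within \<delta> E u v l"
  shows "\<exists>ws. is_walk E u v ws" "graph_dist \<delta> E u v \<le> l"
proof -
  obtain ws where ws: "is_walk E u v ws" "walk_len \<delta> ws \<le> l"
    using c unfolding connected_within_def by blast
  then show "\<exists>ws. is_walk E u v ws" by blast
  have "walk_len \<delta> xs \<ge> 0" if "is_walk E u v xs" for xs
    using that u
  proof (induction xs arbitrary: u)
    case (Cons x xs)
    show ?case
    proof (cases xs)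
      case Nil
      then show ?thesis by (simp add: walk_len_def)
    next
      case (Cons y zs)
      then have "x = u" "adj E x y" and w: "is_walk E y v xs"
        using Cons.prems(1) by (auto simp: is_walk_Cons)
      then have "y \<in> H" "x \<in> H" using E by (auto simp: adj_def)
      then show ?thesis
        using Cons.IH[OF w] nonneg[of x y] \<open>xs = y # zs\<close> by (simp add: walk_len_Cons)
    qed
  qed (simp add: is_walk_def)
  then have "bdd_below {walk_len \<delta> ws | ws. is_walk E u v ws}" by (intro bdd_belowI[of _ 0]) auto
  then have "graph_dist \<delta> E u v \<le> walk_len \<delta> ws"
    unfolding graph_dist_def using ws(1) by (intro cInf_lower) auto
  then show "graph_dist \<delta> E u v \<le> l" using ws(2) by simp
qed

text \<open>As \<open>d \<ge> 2\<close>, absolute constants are bounded by powers of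
  \<open>d\<close>: \<open>10 ^ 6 \<le> 2 ^ 20\<close> and \<open>24 \<le> 2 ^ 5\<close>. The
  exponent \<open>5 + 21 * (d + 1)\<close> is at most \<open>47 * d\<close>.\<close>

lemma dimension_factor_le:
  assumes "d \<ge> 2"
  shows "24 * (10 ^ 6 * real d) ^ (d + 1) \<le> real d ^ (47 * d)"
proof -
  have "(2::real) ^ 20 \<le> real d ^ 20" using assms by (intro power_mono) auto
  then have "10 ^ 6 \<le> real d ^ 20" by simp
  then have "10 ^ 6 * real d \<le> real d ^ 20 * real d" by (intro mult_right_mono) auto
  also have "\<dots> = real d ^ 21" using power_Suc2[of "real d" 20] by simp
  finally have "(10 ^ 6 * real d) ^ (d + 1) \<le> (real d ^ 21) ^ (d + 1)" by (intro power_mono) auto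
  moreover have "(2::real) ^ 5 \<le> real d ^ 5" using assms by (intro power_mono) auto
  then have "24 \<le> real d ^ 5" by simp
  ultimately have "24 * (10 ^ 6 * real d) ^ (d + 1) \<le> real d ^ 5 * (real d ^ 21) ^ (d + 1)"
    by (intro mult_mono) auto
  also have "\<dots> = real d ^ (5 + 21 * (d + 1))" by (simp only: power_mult power_add)
  also have "\<dots> \<le> real d ^ (47 * d)" using assms by (intro power_increasing) auto
  finally show ?thesis .
qed

theorem mainTheorem12:
  shows "\<exists>C::real. \<forall>(d::nat) (\<epsilon>::real) P.
     d \<ge> 2 \<longrightarrow> 0 < \<epsilon> \<longrightarrow> \<epsilon> \<le> 1/2 \<longrightarrow> finite P \<longrightarrow> P \<subseteq> hyp_space d \<longrightarrow>
     (\<exists>Q E. bipartite_steiner_spanner d (1 + \<epsilon>) P Q E \<and>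
        (\<forall>p\<in>P. real (degree E p) \<le>
           (if d = 2 then C * (1 / \<epsilon>) * ln (1 / \<epsilon>)
            else real d powr (C * real d) * \<epsilon> powr ((1 - real d) / 2) * ln (1 / \<epsilon>))))"
proof (intro exI[of _ "2 ^ 94"] allI impI)
  fix d :: nat and \<epsilon> :: real and P :: "(nat \<Rightarrow> real) set"
  assume d: "d \<ge> 2" and \<epsilon>: "0 < \<epsilon>" "\<epsilon> \<le> 1 / 2" and P: "finite P" "P \<subseteq> hyp_space d"
  have d1: "d \<ge> 1" using d by simp
  define N where "N = (10 ^ 6 * real d) ^ (d + 1) * steiner_growth d \<epsilon>"
  have g0: "steiner_growth d \<epsilon> \<ge> 0" using \<epsilon> by (simp add: steiner_growth_def)
  have N0: "N \<ge> 0" unfolding N_def using g0 by simp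
  interpret finite_metric P "hdist d"
    using P hdist_refl[of _ d] hdist_commute[of d] hdist_triangle[OF _ _ _ d1]
    by unfold_locales blast+
  obtain k where k: "160 / \<epsilon> \<le> 8 ^ k" "real k + 1 \<le> 12 * ln (1 / \<epsilon>)"
    using exists_level_count[OF \<epsilon>] by blast
  have "\<exists>Q E. finite Q \<and> Q \<subseteq> hyp_space d - P \<and> E \<subseteq> P \<times> Q \<and>
    (\<forall>u\<in>P. \<forall>v\<in>P. connected_within (hdist d) E u v ((1 + \<epsilon>) * hdist d u v)) \<and>
    (\<forall>p\<in>P. real (degree E p) \<le> 2 * (real k + 1) * N)"
  proof (rule exists_bounded_degree_spanner[OF P(2) _ \<epsilon> k(1) _ N0])
    show "hdist d p q > 0" if "p \<in> P" "q \<in> P" "p \<noteq> q" for p q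
      using hdist_pos[OF _ _ d1 that(3)] that P by blast
    show "\<exists>S. (\<forall>u\<in>hyp_space d. finite (S u) \<and> S u \<subseteq> hyp_space d - P \<and> real (card (S u)) \<le> N) \<and>
      (\<forall>u\<in>hyp_space d. \<forall>v\<in>hyp_space d. R / 16 \<le> hdist d u v \<longrightarrow> hdist d u v \<le> 2 * R \<longrightarrow>
        (\<exists>q\<in>S u \<inter> S v. hdist d u q + hdist d q v \<le> hdist d u v + \<epsilon> * R / 16))" if "R > 0" for R
      unfolding N_def by (rule exists_steiner_system[OF d \<epsilon> that P(1)])
  qed
  then obtain Q E where QE: "finite Q" "Q \<subseteq> hyp_space d - P" "E \<subseteq> P \<times> Q"
    and conn: "\<And>u v. u \<in> P \<Longrightarrow> v \<in> P \<Longrightarrow> connected_within (hdist d) E u v ((1 + \<epsilon>) * hdist d u v)"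
    and deg: "\<And>p. p \<in> P \<Longrightarrow> real (degree E p) \<le> 2 * (real k + 1) * N" by blast
  have EH: "E \<subseteq> hyp_space d \<times> hyp_space d" using QE P by blast
  have "bipartite_steiner_spanner d (1 + \<epsilon>) P Q E"
    unfolding bipartite_steiner_spanner_def
    using QE graph_dist_le[OF EH _ hdist_nonneg[OF _ _ d1] conn] P by blast
  moreover have "real (degree E p) \<le>
           (if d = 2 then 2 ^ 94 * (1 / \<epsilon>) * ln (1 / \<epsilon>)
            else real d powr (2 ^ 94 * real d) * \<epsilon> powr ((1 - real d) / 2) * ln (1 / \<epsilon>))"
    if p: "p \<in> P" for p
  proof -
    have ln0: "ln (1 / \<epsilon>) \<ge> 0" using \<epsilon> by simp
    have "real (degree E p) \<le> 2 * (real k + 1) * N" by (rule deg[OF p])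
    also have "\<dots> \<le> 2 * (12 * ln (1 / \<epsilon>)) * N" using k(2) N0 by (intro mult_right_mono) auto
    also have "\<dots> = (24 * (10 ^ 6 * real d) ^ (d + 1)) * steiner_growth d \<epsilon> * ln (1 / \<epsilon>)"
      by (simp add: N_def)
    also have "\<dots> \<le> real d ^ (47 * d) * steiner_growth d \<epsilon> * ln (1 / \<epsilon>)"
      using g0 ln0 by (intro mult_right_mono dimension_factor_le d)
    finally have le: "real (degree E p) \<le> real d ^ (47 * d) * steiner_growth d \<epsilon> * ln (1 / \<epsilon>)" .
    show ?thesis
    proof (cases "d = 2")
      case True
      \<comment> \<open>Here the dimension factor is \<open>2 ^ (47 * 2)\<close>, which is the
        chosen constant \<open>2 ^ 94\<close>.\<close>
      then show ?thesis using le by (simp add: steiner_growth_def)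
    next
      case False
      have "real d ^ (47 * d) = real d powr (47 * real d)"
        using d by (simp flip: powr_realpow)
      also have "\<dots> \<le> real d powr (2 ^ 94 * real d)" using d by (intro powr_mono) auto
      finally have 1: "real d ^ (47 * d) \<le> real d powr (2 ^ 94 * real d)" .
      have "1 / sqrt \<epsilon> = \<epsilon> powr (- 1 / 2)"
        using \<epsilon> by (simp add: powr_minus_divide powr_half_sqrt)
      then have "steiner_growth d \<epsilon> = (\<epsilon> powr (- 1 / 2)) ^ (d - 1)"
        using False by (simp add: steiner_growth_def)
      also have "\<dots> = \<epsilon> powr (real (d - 1) * (- 1 / 2))"
        using \<epsilon> by (simp add: powr_realpow[symmetric] powr_powr mult.commute)
      also have "real (d - 1) * (- 1 / 2) = (1 - real d) / 2" using d by (simp add: of_nat_diff field_simps)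
      finally have 2: "steiner_growth d \<epsilon> = \<epsilon> powr ((1 - real d) / 2)" .
      have "real d ^ (47 * d) * steiner_growth d \<epsilon> * ln (1 / \<epsilon>)
          \<le> real d powr (2 ^ 94 * real d) * steiner_growth d \<epsilon> * ln (1 / \<epsilon>)"
        using 1 g0 ln0 by (intro mult_right_mono)
      then show ?thesis using le False unfolding 2 by simp
    qed
  qed
  ultimately show "\<exists>Q E. bipartite_steiner_spanner d (1 + \<epsilon>) P Q E \<and>
        (\<forall>p\<in>P. real (degree E p) \<le>
           (if d = 2 then 2 ^ 94 * (1 / \<epsilon>) * ln (1 / \<epsilon>)
            else real d powr (2 ^ 94 * real d) * \<epsilon> powr ((1 - real d) / 2) * ln (1 / \<epsilon>)))"
    by blast
qed

end
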